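(* Let $K\subseteq\mathbb{R}^n$ be a centrally symmetric convex set. Then $\mathbf{Inf}_v[K]\ge0$ for all unit vectors $v\in S^{n-1}$, with equality if and only if $K(x)=K(y)$ whenever $x_{v^\perp}=y_{v^\perp}$, except possibly on a set of measure zero (i.e. there is a null set $N\subseteq\mathbb{R}^n$ such that $K(x)=K(y)$ for all $x,y\notin N$ with $x_{v^\perp}=y_{v^\perp}$).
   Context: The set $K$ is identified with its indicator function $K:\mathbb{R}^n\to\{0,1\}$; centrally symmetric means $K(x)=K(-x)$ for all $x$. For a unit vector $v$, $x_{v^\perp}$ denotes the orthogonal projection of $x$ onto the hyperplane $v^\perp$. The influence of $K$ along direction $v\in S^{n-1}$ is $$\mathbf{Inf}_v[K]:=\mathbb{E}_{x\sim\mathcal{N}(0,1)^n}\left[-K(x)\,h_2(v\cdot x)\right],\qquad h_2(s)=\frac{s^2-1}{\sqrt2},$$ where $\mathcal{N}(0,1)^n$ is the standard Gaussian distribution on $\mathbb{R}^n$. *)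

theory Defs
  imports "HOL-Probability.Probability"
begin

(* A convex set need not be Borel, but it is always Lebesgue measurable.  The Gaussian measure
   is therefore taken on the Lebesgue sets; on a Borel sigma-algebra the integral of a
   non-Borel indicator would silently be 0. *)
definition std_gaussian :: "(real ^ 'n) measure" where
  "std_gaussian = density lebesgue (\<lambda>x. ennreal (\<Prod>i\<in>UNIV. std_normal_density (x $ i)))"

lemma prob_space_std_gaussian: "prob_space (std_gaussian :: (real ^ 'n) measure)"
proof
  let ?g = "\<lambda>x::real ^ 'n. ennreal (\<Prod>i\<in>UNIV. std_normal_density (x $ i))"
  let ?B = "Basis :: (real ^ 'n) set"
  have g: "?g = (\<lambda>x. \<Prod>b\<in>?B. ennreal (std_normal_density (x \<bullet> b)))"
  proof
    fix x :: "real ^ 'n"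
    have B: "?B = (\<lambda>i. axis i 1) ` UNIV"
      by (auto simp: Basis_vec_def)
    have inj: "inj (\<lambda>i::'n. axis i (1::real))"
      by (auto simp: inj_on_def axis_eq_axis)
    show "?g x = (\<Prod>b\<in>?B. ennreal (std_normal_density (x \<bullet> b)))"
      unfolding B prod.reindex[OF inj] by (simp add: prod_ennreal inner_axis)
  qed
  have one: "(\<integral>\<^sup>+ t. ennreal (std_normal_density t) \<partial>lborel) = 1"
    using prob_space.emeasure_space_1[OF prob_space_normal_density[of 1 0]]
    by (simp add: emeasure_density)
  have meas: "?g \<in> borel_measurable lborel"
    unfolding g by measurable
  have "emeasure (std_gaussian :: (real ^ 'n) measure) (space std_gaussian) = (\<integral>\<^sup>+ x. ?g x \<partial>lebesgue)"
    unfolding std_gaussian_def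
    using meas by (simp add: emeasure_density measurable_completion)
  also have "\<dots> = (\<integral>\<^sup>+ x. ?g x \<partial>lborel)"
    using meas by (simp add: nn_integral_completion)
  also have "\<dots> = 1"
    unfolding g by (subst nn_integral_lborel_prod) (auto simp: one)
  finally show "emeasure (std_gaussian :: (real ^ 'n) measure) (space std_gaussian) = 1" .
qed

definition h2 :: "real \<Rightarrow> real" where
  "h2 s = (s\<^sup>2 - 1) / sqrt 2"

definition Inf_dir :: "real ^ 'n \<Rightarrow> (real ^ 'n) set \<Rightarrow> real" where
  "Inf_dir v K = (\<integral>x. - indicat_real K x * h2 (v \<bullet> x) \<partial>std_gaussian)"

definition centrally_symmetric :: "(real ^ 'n) set \<Rightarrow> bool" where
  "centrally_symmetric K \<longleftrightarrow> (\<forall>x. indicat_real K x = indicat_real K (- x))"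

(* Orthogonal projection onto the hyperplane orthogonal to v; intended for unit vectors v only. *)
definition proj_perp :: "real ^ 'n \<Rightarrow> real ^ 'n \<Rightarrow> real ^ 'n" where
  "proj_perp v x = x - (v \<bullet> x) *\<^sub>R v"

lemma proj_perp_eq_iff:
  assumes "norm v = 1"
  shows "p = proj_perp v x \<longleftrightarrow> orthogonal v p \<and> (\<forall>w. orthogonal v w \<longrightarrow> orthogonal (x - p) w)"
proof safe
  have vv: "v \<bullet> v = 1"
    using assms by (simp add: norm_eq_1)
  show o: "orthogonal v (proj_perp v x)"
    by (simp add: orthogonal_def proj_perp_def inner_diff_right vv)
  show q: "orthogonal (x - proj_perp v x) w" if "orthogonal v w" for w
    using that by (simp add: orthogonal_def proj_perp_def)
  assume p: "orthogonal v p" and c: "\<forall>w. orthogonal v w \<longrightarrow> orthogonal (x - p) w"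
  define d where "d = proj_perp v x - p"
  have d: "orthogonal v d"
    using o p by (simp add: d_def orthogonal_def inner_diff_right)
  have "d \<bullet> d = (x - p) \<bullet> d - (x - proj_perp v x) \<bullet> d"
    by (simp add: d_def inner_diff_left)
  also have "\<dots> = 0"
    using c q d by (simp add: orthogonal_def)
  finally show "p = proj_perp v x"
    by (simp add: d_def)
qed

end

theory Submission imports Defs begin

text \<open>Let \<open>f s\<close> be the Gaussian measure of the slice of \<open>K\<close> at height \<open>s\<close> in direction \<open>v\<close>. Then the
  influence is a positive multiple of the integral of \<open>f s * (1 - s\<^sup>2)\<close> against the standard normal law.
  By Prekopa's theorem \<open>f\<close> is log-concave, and it is even by symmetry, so it decreases in \<open>\<bar>s\<bar>\<close>.
  As \<open>1 - s\<^sup>2\<close> has mean zero, the integral equals that of \<open>(f s - f 1) * (1 - s\<^sup>2)\<close>, whose integrand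
  is nonnegative, and it vanishes only if \<open>f\<close> is almost everywhere constant.
  If the line spanned by \<open>v\<close> is not contained in the interior of \<open>K\<close> (assumed nonempty), then \<open>K\<close> leaves
  every parallel line, \<open>f\<close> tends to zero at infinity, and the integral is positive. If the interior
  contains that line it is invariant under translation along \<open>v\<close>, and it differs from \<open>K\<close> by a null set.\<close>

subsection \<open>Prekopa's theorem in one dimension\<close>

text \<open>Log-concavity is stated through \<open>exp\<close> of real exponents because it then makes sense for functions
  with values in \<open>ennreal\<close>, zeros included, without powers of extended reals.\<close>

definition log_concave :: "('a::real_vector \<Rightarrow> ennreal) \<Rightarrow> bool" where
  "log_concave F \<longleftrightarrow> (\<forall>x y \<alpha> \<beta> u. 0 \<le> u \<longrightarrow> u \<le> 1 \<longrightarrow>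
     ennreal (exp \<alpha>) \<le> F x \<longrightarrow> ennreal (exp \<beta>) \<le> F y \<longrightarrow>
     ennreal (exp ((1 - u) * \<alpha> + u * \<beta>)) \<le> F ((1 - u) *\<^sub>R x + u *\<^sub>R y))"

lemma log_concaveD:
  assumes "log_concave F" "0 \<le> u" "u \<le> 1" "ennreal (exp \<alpha>) \<le> F x" "ennreal (exp \<beta>) \<le> F y"
  shows "ennreal (exp ((1 - u) * \<alpha> + u * \<beta>)) \<le> F ((1 - u) *\<^sub>R x + u *\<^sub>R y)"
  using assms unfolding log_concave_def by blast

text \<open>When the supremum is finite, \<open>A\<close> fits into an interval of that length
  starting at \<open>Inf A\<close>. This trades the measure of a set for distances between pairs of
  its points.\<close>

lemma emeasure_lborel_le_SUP_diff:
  fixes A :: "real set"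
  shows "emeasure lborel A \<le> (SUP p\<in>A \<times> A. ennreal (snd p - fst p))" (is "_ \<le> ?D")
proof (cases "A = {} \<or> ?D = \<top>")
  case False
  then obtain c where c: "0 \<le> c" "?D = ennreal c"
    by (cases ?D) auto
  have diff: "y - x \<le> c" if "x \<in> A" "y \<in> A" for x y
  proof -
    have "ennreal (y - x) \<le> ?D"
      using that by (intro SUP_upper2[of "(x, y)"]) auto
    then show ?thesis using c by (auto simp: ennreal_le_iff2)
  qed
  obtain z where z: "z \<in> A" using False by auto
  have bdd: "bdd_below A"
    using diff[OF _ z] by (intro bdd_belowI[of _ "z - c"]) force
  have "A \<subseteq> {Inf A .. Inf A + c}"
  proof
    fix y assume y: "y \<in> A"
    have "y - c \<le> Inf A"
      using diff[OF _ y] z by (intro cInf_greatest) force+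
    then show "y \<in> {Inf A .. Inf A + c}"
      using cInf_lower[OF y bdd] by simp
  qed
  then have "emeasure lborel A \<le> emeasure lborel {Inf A .. Inf A + c}"
    by (intro emeasure_mono) auto
  then show ?thesis using c by simp
next
  case True
  then show ?thesis
  proof
    assume "?D = \<top>"
    then show ?thesis by (metis top_greatest)
  qed simp
qed

text \<open>Two points of \<open>A\<close> and two of \<open>B\<close> combine to two points of
  \<open>S\<close>, and convexity puts the interval between them into \<open>S\<close>. Its length
  is the weighted sum of the two distances; suprema over all pairs give the claim.\<close>

lemma brunn_minkowski_real_convex:
  fixes A B S :: "real set"
  assumes u: "0 \<le> u" "u \<le> 1" and ne: "A \<noteq> {}" "B \<noteq> {}"
    and S: "convex S" "S \<in> sets lborel"
    and sub: "\<And>a b. a \<in> A \<Longrightarrow> b \<in> B \<Longrightarrow> (1 - u) * a + u * b \<in> S"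
  shows "ennreal (1 - u) * emeasure lborel A + ennreal u * emeasure lborel B \<le> emeasure lborel S"
proof -
  have pts: "ennreal (1 - u) * ennreal (snd p - fst p) + ennreal u * ennreal (snd q - fst q)
      \<le> emeasure lborel S" if "p \<in> A \<times> A" "q \<in> B \<times> B" for p q
  proof -
    define m where "m a b = (1 - u) * a + u * b" for a b
    \<comment> \<open>Pairing minima with minima and maxima with maxima makes \<open>x1 - x0\<close>
      the weighted sum of the absolute distances, however each pair is ordered.\<close>
    define x0 where "x0 = m (min (fst p) (snd p)) (min (fst q) (snd q))"
    define x1 where "x1 = m (max (fst p) (snd p)) (max (fst q) (snd q))"
    have in_S: "x0 \<in> S" "x1 \<in> S"
      using that sub unfolding x0_def x1_def m_def by (auto simp: min_def max_def)
    have le: "x0 \<le> x1"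
      unfolding x0_def x1_def m_def using u by (intro add_mono mult_left_mono) auto
    have "{x0..x1} \<subseteq> S"
      using convex_contains_segment[of S] in_S S(1) le closed_segment_eq_real_ivl[of x0 x1] by metis
    then have "ennreal (x1 - x0) \<le> emeasure lborel S"
      using emeasure_mono[of "{x0..x1}" S lborel] S(2) le by simp
    moreover have "ennreal (1 - u) * ennreal (snd p - fst p) + ennreal u * ennreal (snd q - fst q)
       \<le> ennreal ((1 - u) * \<bar>snd p - fst p\<bar> + u * \<bar>snd q - fst q\<bar>)"
      using u by (simp add: ennreal_plus ennreal_mult del: ennreal_minus)
        (intro add_mono mult_left_mono ennreal_leI; simp)
    moreover have "(1 - u) * \<bar>snd p - fst p\<bar> + u * \<bar>snd q - fst q\<bar> = x1 - x0"
      unfolding x0_def x1_def m_def by (auto simp: min_def max_def algebra_simps abs_if)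
    ultimately show ?thesis by simp
  qed
  have "ennreal (1 - u) * emeasure lborel A + ennreal u * emeasure lborel B
     \<le> ennreal (1 - u) * (SUP p\<in>A \<times> A. ennreal (snd p - fst p))
       + ennreal u * (SUP q\<in>B \<times> B. ennreal (snd q - fst q))"
    by (intro add_mono mult_left_mono emeasure_lborel_le_SUP_diff) auto
  \<comment> \<open>A constant summand may be moved into a supremum when the index set is nonempty;
    this is where \<open>ne\<close> enters.\<close>
  also have "\<dots> = (SUP p\<in>A \<times> A. SUP q\<in>B \<times> B.
      ennreal (1 - u) * ennreal (snd p - fst p) + ennreal u * ennreal (snd q - fst q))"
    using ne by (simp only: SUP_mult_left_ennreal)
      (subst ennreal_SUP_add_left[symmetric], simp, subst ennreal_SUP_add_right[symmetric], auto)
  also have "\<dots> \<le> emeasure lborel S"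
    by (intro SUP_least pts)
  finally show ?thesis .
qed

text \<open>Layer cake formula: \<open>f x\<close> is the length of the set of levels
  \<open>\<theta>\<close> below it, and Tonelli swaps the two integrals. By \<open>le1\<close> the
  levels can stop at 1.\<close>

lemma nn_integral_eq_superlevel:
  fixes f :: "real \<Rightarrow> ennreal"
  assumes [measurable]: "f \<in> borel_measurable borel" and le1: "\<And>x. f x \<le> 1"
  shows "(\<integral>\<^sup>+x. f x \<partial>lborel)
    = (\<integral>\<^sup>+\<theta>\<in>{0<..<1}. emeasure lborel {x. ennreal \<theta> < f x} \<partial>lborel)"
proof -
  have pt: "f x = (\<integral>\<^sup>+\<theta>. indicator {x. ennreal \<theta> < f x} x * indicator {0<..<1} \<theta> \<partial>lborel)" for x
  proof -
    obtain r where r: "f x = ennreal r" "0 \<le> r" "r \<le> 1"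
      using le1[of x] by (cases "f x") (auto simp: ennreal_le_1 top_unique)
    have "(\<integral>\<^sup>+\<theta>. indicator {x. ennreal \<theta> < f x} x * indicator {0<..<1} \<theta> \<partial>lborel)
       = (\<integral>\<^sup>+\<theta>. indicator {0<..<r} \<theta> \<partial>lborel)"
      using r by (intro nn_integral_cong) (auto split: split_indicator simp: ennreal_less_iff)
    then show ?thesis using r by simp
  qed
  have "(\<integral>\<^sup>+x. f x \<partial>lborel)
     = (\<integral>\<^sup>+x. \<integral>\<^sup>+\<theta>. indicator {x. ennreal \<theta> < f x} x * indicator {0<..<1} \<theta> \<partial>lborel \<partial>lborel)"
    by (intro nn_integral_cong pt)
  also have "\<dots> = (\<integral>\<^sup>+\<theta>. \<integral>\<^sup>+x. indicator {x. ennreal \<theta> < f x} x * indicator {0<..<1} \<theta> \<partial>lborel \<partial>lborel)"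
    by (intro lborel_pair.Fubini') (simp add: indicator_def, measurable)
  also have "\<dots> = (\<integral>\<^sup>+\<theta>\<in>{0<..<1}. emeasure lborel {x. ennreal \<theta> < f x} \<partial>lborel)"
    by (intro nn_integral_cong) (subst nn_integral_multc, auto)
  finally show ?thesis .
qed

lemma superlevel_measurable [measurable]:
  fixes f :: "real \<Rightarrow> ennreal"
  assumes [measurable]: "f \<in> borel_measurable borel"
  shows "(\<lambda>\<theta>. emeasure lborel {x. ennreal \<theta> < f x}) \<in> borel_measurable borel"
proof -
  have "(\<lambda>\<theta>. emeasure lborel {x \<in> space lborel. ennreal \<theta> < f x}) \<in> borel_measurable borel"
    by measurable
  then show ?thesis by simp
qed

text \<open>At each level in (0,1) the superlevel sets of \<open>f\<close> and \<open>g\<close> are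
  nonempty, so \<open>brunn_minkowski_real_convex\<close> applies, and the layer cake formula
  integrates the result. The bound obtained is additive, hence at least as strong as the
  multiplicative one.\<close>

lemma prekopa_leindler_normalized:
  fixes f g h :: "real \<Rightarrow> ennreal"
  assumes u: "0 \<le> u" "u \<le> 1"
    and [measurable]: "f \<in> borel_measurable borel" "g \<in> borel_measurable borel" "h \<in> borel_measurable borel"
    and le1: "\<And>x. f x \<le> 1" "\<And>x. g x \<le> 1"
    and ne: "\<And>\<theta>. 0 < \<theta> \<Longrightarrow> \<theta> < 1 \<Longrightarrow> \<exists>x. ennreal \<theta> < f x" "\<And>\<theta>. 0 < \<theta> \<Longrightarrow> \<theta> < 1 \<Longrightarrow> \<exists>x. ennreal \<theta> < g x"
    and conv: "\<And>\<theta>. 0 < \<theta> \<Longrightarrow> \<theta> < 1 \<Longrightarrow> convex {x. ennreal \<theta> < h x}"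
    and fgh: "\<And>\<theta> s r. 0 < \<theta> \<Longrightarrow> \<theta> < 1 \<Longrightarrow> ennreal \<theta> < f s \<Longrightarrow> ennreal \<theta> < g r
      \<Longrightarrow> ennreal \<theta> < h ((1 - u) * s + u * r)"
  shows "ennreal (1 - u) * (\<integral>\<^sup>+x. f x \<partial>lborel) + ennreal u * (\<integral>\<^sup>+x. g x \<partial>lborel) \<le> (\<integral>\<^sup>+x. h x \<partial>lborel)"
proof -
  let ?L = "\<lambda>f \<theta>. emeasure lborel {x. ennreal \<theta> < f x} * indicator {0<..<1} \<theta>"
  have "ennreal (1 - u) * (\<integral>\<^sup>+x. f x \<partial>lborel) + ennreal u * (\<integral>\<^sup>+x. g x \<partial>lborel)
     = (\<integral>\<^sup>+\<theta>. ennreal (1 - u) * ?L f \<theta> + ennreal u * ?L g \<theta> \<partial>lborel)"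
    by (simp add: nn_integral_eq_superlevel le1 nn_integral_add nn_integral_cmult)
  \<comment> \<open>\<open>h\<close> may exceed 1; truncating it leaves the superlevel sets at
    levels below 1 unchanged.\<close>
  also have "\<dots> \<le> (\<integral>\<^sup>+\<theta>. ?L (\<lambda>x. min (h x) 1) \<theta> \<partial>lborel)"
  proof (intro nn_integral_mono)
    fix \<theta> :: real
    show "ennreal (1 - u) * ?L f \<theta> + ennreal u * ?L g \<theta> \<le> ?L (\<lambda>x. min (h x) 1) \<theta>"
    proof (cases "\<theta> \<in> {0<..<1}")
      case True
      then have eq: "{x. ennreal \<theta> < min (h x) 1} = {x. ennreal \<theta> < h x}"
        by (auto simp: ennreal_less_one_iff)
      have "{x. ennreal \<theta> < h x} \<in> sets lborel"
        by simp
      with brunn_minkowski_real_convex[OF u, of "{x. ennreal \<theta> < f x}" "{x. ennreal \<theta> < g x}"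
          "{x. ennreal \<theta> < h x}"] True ne[of \<theta>] conv[of \<theta>] fgh[of \<theta>]
      show ?thesis unfolding eq by auto
    qed simp
  qed
  also have "\<dots> = (\<integral>\<^sup>+x. min (h x) 1 \<partial>lborel)"
    by (subst (2) nn_integral_eq_superlevel) auto
  also have "\<dots> \<le> (\<integral>\<^sup>+x. h x \<partial>lborel)"
    by (intro nn_integral_mono) simp
  finally show ?thesis .
qed

text \<open>Turns a level inequality into one between exponents, the language of
  \<open>log_concave\<close>. For \<open>x = 0\<close> no \<open>p\<close> qualifies; for
  \<open>x = \<top>\<close> every large \<open>p\<close> does.\<close>

lemma less_mult_exp_iff:
  assumes "0 < \<theta>"
  shows "ennreal \<theta> < x * ennreal (exp (- a)) \<longleftrightarrow> (\<exists>p. ennreal (exp p) \<le> x \<and> ln \<theta> + a < p)"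
proof (cases x)
  case (real y)
  have eq: "x * ennreal (exp (- a)) = ennreal (y * exp (- a))"
    using real by (simp add: ennreal_mult)
  have iff: "ennreal \<theta> < x * ennreal (exp (- a)) \<longleftrightarrow> exp (ln \<theta> + a) < y"
    unfolding eq using assms by (simp add: ennreal_less_iff exp_add exp_minus field_simps)
  show ?thesis
  proof (cases "y = 0")
    case True
    then show ?thesis using real iff by (auto simp: ennreal_le_iff2 not_less[symmetric])
  next
    case False
    then have y: "y > 0" using real by simp
    have "exp (ln \<theta> + a) < y \<longleftrightarrow> ln \<theta> + a < ln y"
      using y by (metis exp_less_cancel_iff exp_ln)
    moreover have "ennreal (exp p) \<le> x \<longleftrightarrow> p \<le> ln y" for p
      using y real by (simp add: ln_ge_iff)
    ultimately show ?thesis using iff by (metis order.refl order.strict_trans2)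
  qed
next
  case top
  then show ?thesis
    by (auto simp: ennreal_top_mult intro!: exI[of _ "ln \<theta> + a + 1"])
qed

lemma SUP_normalized:
  fixes f :: "'a \<Rightarrow> ennreal"
  assumes A: "(SUP x. f x) = ennreal (exp a)"
  shows "f x * ennreal (exp (- a)) \<le> 1" "\<theta> < 1 \<Longrightarrow> \<exists>x. ennreal \<theta> < f x * ennreal (exp (- a))"
proof -
  have one: "ennreal (exp a) * ennreal (exp (- a)) = 1"
    by (simp add: ennreal_mult[symmetric] exp_add[symmetric])
  have "f x \<le> ennreal (exp a)" using A by (metis SUP_upper UNIV_I)
  then show "f x * ennreal (exp (- a)) \<le> 1"
    by (metis one mult_right_mono zero_le)
  assume "\<theta> < 1"
  then have "ennreal \<theta> < (SUP x. f x * ennreal (exp (- a)))"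
    using one by (simp add: SUP_mult_right_ennreal[symmetric] A)
  then show "\<exists>x. ennreal \<theta> < f x * ennreal (exp (- a))"
    by (simp add: less_SUP_iff)
qed

text \<open>Dividing \<open>f\<close> and \<open>g\<close> by their suprema, and \<open>h\<close> by
  the weighted geometric mean of these, gives the normalized situation. Its additive bound becomes
  multiplicative by convexity of \<open>exp\<close>. Log-concavity of \<open>h\<close> makes its
  superlevel sets convex.\<close>

lemma prekopa_leindler_real:
  fixes f g h :: "real \<Rightarrow> ennreal"
  assumes u: "0 \<le> u" "u \<le> 1"
    and meas [measurable]: "f \<in> borel_measurable borel" "g \<in> borel_measurable borel" "h \<in> borel_measurable borel"
    and bdd: "(SUP x. f x) < \<top>" "(SUP x. g x) < \<top>"
    and h: "log_concave h"
    and fgh: "\<And>s r \<alpha> \<beta>. ennreal (exp \<alpha>) \<le> f s \<Longrightarrow> ennreal (exp \<beta>) \<le> g r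
      \<Longrightarrow> ennreal (exp ((1 - u) * \<alpha> + u * \<beta>)) \<le> h ((1 - u) * s + u * r)"
    and int: "ennreal (exp \<alpha>) \<le> (\<integral>\<^sup>+x. f x \<partial>lborel)" "ennreal (exp \<beta>) \<le> (\<integral>\<^sup>+x. g x \<partial>lborel)"
  shows "ennreal (exp ((1 - u) * \<alpha> + u * \<beta>)) \<le> (\<integral>\<^sup>+x. h x \<partial>lborel)"
proof -
  \<comment> \<open>A positive integral excludes the supremum 0, so the finite supremum has a
    logarithm.\<close>
  have sup: "\<exists>a. (SUP x. f x) = ennreal (exp a)"
    if f: "(SUP x. f x) < \<top>" "ennreal (exp \<alpha>) \<le> (\<integral>\<^sup>+x. f x \<partial>lborel)" for f :: "real \<Rightarrow> ennreal" and \<alpha>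
  proof -
    obtain A where A: "(SUP x. f x) = ennreal A" "0 \<le> A"
      using f(1) by (cases "SUP x. f x") auto
    have "A \<noteq> 0"
    proof
      assume "A = 0"
      then have "f x = 0" for x using A by (metis SUP_upper UNIV_I ennreal_0 le_zero_eq)
      then show False using f(2) by (simp add: ennreal_le_iff2 not_le[symmetric])
    qed
    then show ?thesis using A by (intro exI[of _ "ln A"]) simp
  qed
  obtain a b where a: "(SUP x. f x) = ennreal (exp a)" and b: "(SUP x. g x) = ennreal (exp b)"
    using sup[OF bdd(1) int(1)] sup[OF bdd(2) int(2)] by blast
  define c where "c = (1 - u) * a + u * b"
  have mix: "ln \<theta> + c < (1 - u) * p + u * q" if "ln \<theta> + a < p" "ln \<theta> + b < q" for \<theta> p q
  proof -
    have "ln \<theta> + c = (1 - u) * (ln \<theta> + a) + u * (ln \<theta> + b)"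
      by (simp add: c_def algebra_simps)
    also have "\<dots> < (1 - u) * p + u * q"
      using that u by (cases "u = 0") (auto intro!: add_le_less_mono mult_left_mono)
    finally show ?thesis .
  qed
  let ?n = "\<lambda>f a x. f x * ennreal (exp (- a))"
  have "ennreal (1 - u) * (\<integral>\<^sup>+x. ?n f a x \<partial>lborel) + ennreal u * (\<integral>\<^sup>+x. ?n g b x \<partial>lborel)
     \<le> (\<integral>\<^sup>+x. ?n h c x \<partial>lborel)"
  proof (rule prekopa_leindler_normalized[OF u])
    fix \<theta> :: real assume \<theta>: "0 < \<theta>" "\<theta> < 1"
    show "ennreal \<theta> < ?n h c ((1 - u) * s + u * r)" if "ennreal \<theta> < ?n f a s" "ennreal \<theta> < ?n g b r" for s r
      using that \<theta> fgh mix unfolding less_mult_exp_iff[OF \<theta>(1)] by blast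
    show "convex {x. ennreal \<theta> < ?n h c x}"
      unfolding convex_alt less_mult_exp_iff[OF \<theta>(1)]
    proof clarsimp
      fix x y p q w
      assume pq: "ennreal (exp p) \<le> h x" "ln \<theta> + c < p" "ennreal (exp q) \<le> h y" "ln \<theta> + c < q"
        and w: "0 \<le> w" "w \<le> (1::real)"
      have "ln \<theta> + c < (1 - w) * p + w * q"
        using convex_bound_lt[of "-p" "-(ln \<theta> + c)" "-q" "1 - w" w] pq w by auto
      then show "\<exists>p. ennreal (exp p) \<le> h ((1 - w) * x + w * y) \<and> ln \<theta> + c < p"
        using log_concaveD[OF h w pq(1,3)] by auto
    qed
  qed (use SUP_normalized[OF a] SUP_normalized[OF b] in auto)
  then have main: "ennreal (1 - u) * ((\<integral>\<^sup>+x. f x \<partial>lborel) * ennreal (exp (- a)))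
      + ennreal u * ((\<integral>\<^sup>+x. g x \<partial>lborel) * ennreal (exp (- b)))
     \<le> (\<integral>\<^sup>+x. h x \<partial>lborel) * ennreal (exp (- c))"
    by (simp add: nn_integral_multc)
  \<comment> \<open>The weighted inequality between arithmetic and geometric means, in exponential
    form.\<close>
  have "exp ((1 - u) * (\<alpha> - a) + u * (\<beta> - b)) \<le> (1 - u) * exp (\<alpha> - a) + u * exp (\<beta> - b)"
    using convex_onD[OF exp_convex, of u "\<alpha> - a" "\<beta> - b"] u by simp
  then have "ennreal (exp ((1 - u) * (\<alpha> - a) + u * (\<beta> - b)))
     \<le> ennreal (1 - u) * ennreal (exp (\<alpha> - a)) + ennreal u * ennreal (exp (\<beta> - b))"
    using u by (simp add: ennreal_mult[symmetric] ennreal_plus[symmetric] ennreal_leI del: ennreal_plus)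
  also have "\<dots> = ennreal (1 - u) * (ennreal (exp \<alpha>) * ennreal (exp (- a)))
      + ennreal u * (ennreal (exp \<beta>) * ennreal (exp (- b)))"
    by (simp add: ennreal_mult[symmetric] exp_add[symmetric])
  also have "\<dots> \<le> ennreal (1 - u) * ((\<integral>\<^sup>+x. f x \<partial>lborel) * ennreal (exp (- a)))
      + ennreal u * ((\<integral>\<^sup>+x. g x \<partial>lborel) * ennreal (exp (- b)))"
    using int by (intro add_mono mult_left_mono mult_right_mono) auto
  also note main
  finally have "ennreal (exp ((1 - u) * (\<alpha> - a) + u * (\<beta> - b))) * ennreal (exp c)
     \<le> (\<integral>\<^sup>+x. h x \<partial>lborel) * ennreal (exp (- c)) * ennreal (exp c)"
    by (intro mult_right_mono) auto
  also have "\<dots> = (\<integral>\<^sup>+x. h x \<partial>lborel)"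
    by (simp add: mult.assoc ennreal_mult[symmetric] exp_add[symmetric])
  also have "ennreal (exp ((1 - u) * (\<alpha> - a) + u * (\<beta> - b))) * ennreal (exp c)
     = ennreal (exp ((1 - u) * \<alpha> + u * \<beta>))"
    by (simp add: ennreal_mult[symmetric] exp_add[symmetric] c_def algebra_simps)
  finally show ?thesis .
qed

section \<open>Log-concavity of one-dimensional Gaussian marginals\<close>

abbreviation std_normal :: "real measure" where
  "std_normal \<equiv> density lborel (\<lambda>t. ennreal (std_normal_density t))"

lemma std_normal_density_le_1: "std_normal_density t \<le> 1"
proof -
  have "1 \<le> sqrt (2 * pi)" using pi_gt3 by simp
  then show ?thesis
    unfolding std_normal_density_def using order_trans[of "exp (- (t\<^sup>2 / 2))" 1]
    by (auto simp: divide_le_eq)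
qed

lemma std_normal_density_log_concave:
  assumes "0 \<le> u" "u \<le> 1"
  shows "(1 - u) * ln (std_normal_density s) + u * ln (std_normal_density r)
    \<le> ln (std_normal_density ((1 - u) * s + u * r))"
proof -
  have ln: "ln (std_normal_density t) = ln (1 / sqrt (2 * pi)) - t\<^sup>2 / 2" for t
    unfolding std_normal_density_def by (subst ln_mult) auto
  have "((1 - u) * s + u * r)\<^sup>2 \<le> (1 - u) * s\<^sup>2 + u * r\<^sup>2"
    using convex_onD[OF convex_power2, of u s r] assms by simp
  then show ?thesis unfolding ln by (simp add: field_simps)
qed

text \<open>The integrand including the normal density is log-concave in \<open>x\<close> and
  \<open>t\<close> jointly. The claim is then the Prekopa-Leindler inequality for its slices at
  \<open>x\<close>, at \<open>y\<close> and at their convex combination.\<close>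

lemma log_concave_marginal:
  fixes F :: "'a::euclidean_space \<Rightarrow> ennreal"
  assumes [measurable]: "F \<in> borel_measurable borel"
    and F: "log_concave F" "\<And>x. F x \<le> 1"
  shows "log_concave (\<lambda>x. \<integral>\<^sup>+t. F (x + t *\<^sub>R c) \<partial>std_normal)"
proof -
  define S where "S x t = F (x + t *\<^sub>R c) * ennreal (std_normal_density t)" for x t
  have [measurable]: "S x \<in> borel_measurable borel" for x
    unfolding S_def by measurable
  have int: "(\<integral>\<^sup>+t. F (x + t *\<^sub>R c) \<partial>std_normal) = (\<integral>\<^sup>+t. S x t \<partial>lborel)" for x
    unfolding S_def by (subst nn_integral_density) (auto simp: mult.commute)
  have S_le: "S x t \<le> 1" for x t
    unfolding S_def using F(2) std_normal_density_le_1 by (intro mult_le_one) auto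
  have S: "ennreal (exp ((1 - u) * \<alpha> + u * \<beta>)) \<le> S ((1 - u) *\<^sub>R x + u *\<^sub>R y) ((1 - u) * s + u * r)"
    if u: "0 \<le> u" "u \<le> 1" and le: "ennreal (exp \<alpha>) \<le> S x s" "ennreal (exp \<beta>) \<le> S y r"
    for u \<alpha> \<beta> x y s r
  proof -
    \<comment> \<open>Dividing by the positive density shifts the exponent by the logarithm of the
      density.\<close>
    have iff: "ennreal (exp \<alpha>) \<le> S x s \<longleftrightarrow> ennreal (exp (\<alpha> - ln (std_normal_density s))) \<le> F (x + s *\<^sub>R c)"
      for \<alpha> x s
    proof -
      define d where "d = std_normal_density s"
      have d: "d > 0" unfolding d_def by (simp add: normal_density_pos)
      have "ennreal (exp \<alpha>) \<le> F (x + s *\<^sub>R c) * ennreal d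
        \<longleftrightarrow> ennreal (exp \<alpha> / d) \<le> F (x + s *\<^sub>R c)"
        using d by (cases "F (x + s *\<^sub>R c)")
          (auto simp: ennreal_mult[symmetric] divide_le_eq ennreal_top_mult ennreal_le_iff2)
      then show ?thesis using d unfolding S_def d_def by (simp add: exp_diff)
    qed
    let ?l = "\<lambda>s. ln (std_normal_density s)"
    have vec: "(1 - u) *\<^sub>R (x + s *\<^sub>R c) + u *\<^sub>R (y + r *\<^sub>R c)
      = ((1 - u) *\<^sub>R x + u *\<^sub>R y) + ((1 - u) * s + u * r) *\<^sub>R c"
      by (simp add: algebra_simps)
    have "(1 - u) * \<alpha> + u * \<beta> - ?l ((1 - u) * s + u * r) \<le> (1 - u) * (\<alpha> - ?l s) + u * (\<beta> - ?l r)"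
      using std_normal_density_log_concave[OF u, of s r] by (simp add: algebra_simps)
    then have "ennreal (exp ((1 - u) * \<alpha> + u * \<beta> - ?l ((1 - u) * s + u * r)))
       \<le> ennreal (exp ((1 - u) * (\<alpha> - ?l s) + u * (\<beta> - ?l r)))"
      by (intro ennreal_leI) simp
    also have "\<dots> \<le> F (((1 - u) *\<^sub>R x + u *\<^sub>R y) + ((1 - u) * s + u * r) *\<^sub>R c)"
      using log_concaveD[OF F(1) u le[unfolded iff]] unfolding vec .
    finally show ?thesis unfolding iff .
  qed
  have bdd: "(SUP t. S x t) < \<top>" for x
    by (rule le_less_trans[of _ 1]) (auto intro: SUP_least S_le)
  show ?thesis
    unfolding log_concave_def int
  proof (intro allI impI)
    fix x y \<alpha> \<beta> and u :: real
    assume u: "0 \<le> u" "u \<le> 1"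
      and ab: "ennreal (exp \<alpha>) \<le> (\<integral>\<^sup>+t. S x t \<partial>lborel)" "ennreal (exp \<beta>) \<le> (\<integral>\<^sup>+t. S y t \<partial>lborel)"
    let ?z = "(1 - u) *\<^sub>R x + u *\<^sub>R y"
    \<comment> \<open>This is the joint inequality \<open>S\<close> with both base points equal to
      \<open>?z\<close>.\<close>
    have "log_concave (S ?z)"
      unfolding log_concave_def
    proof (intro allI impI)
      fix s r \<alpha> \<beta> and w :: real
      assume w: "0 \<le> w" "w \<le> 1" "ennreal (exp \<alpha>) \<le> S ?z s" "ennreal (exp \<beta>) \<le> S ?z r"
      have z: "(1 - w) *\<^sub>R ?z + w *\<^sub>R ?z = ?z"
        by (simp add: scaleR_left_distrib[symmetric])
      show "ennreal (exp ((1 - w) * \<alpha> + w * \<beta>)) \<le> S ?z ((1 - w) *\<^sub>R s + w *\<^sub>R r)"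
        using S[OF w] unfolding z by simp
    qed
    then show "ennreal (exp ((1 - u) * \<alpha> + u * \<beta>)) \<le> (\<integral>\<^sup>+t. S ?z t \<partial>lborel)"
      by (intro prekopa_leindler_real[where f = "S x" and g = "S y"] u bdd ab S) auto
  qed
qed

subsection \<open>Rotation invariance of the Gaussian measure\<close>

lemma nn_integral_lborel_translation:
  fixes h :: "'a::euclidean_space \<Rightarrow> ennreal"
  assumes [measurable]: "h \<in> borel_measurable borel"
  shows "(\<integral>\<^sup>+x. h (a + x) \<partial>lborel) = (\<integral>\<^sup>+x. h x \<partial>lborel)"
proof -
  have "(\<integral>\<^sup>+x. h x \<partial>lborel) = (\<integral>\<^sup>+x. h x \<partial>distr lborel borel ((+) a))"
    by (simp add: lborel_distr_plus)
  then show ?thesis by (simp add: nn_integral_distr)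
qed

text \<open>The image measure is again translation invariant. Evaluating the double integral of
  \<open>f (T x) * g (T x + y)\<close> in both orders, with \<open>f\<close> the indicator of the unit ball, shows that it agrees
  with Lebesgue measure: this is the uniqueness of Haar measure, and \<open>T\<close> preserves the ball.\<close>

lemma lborel_distr_orthogonal:
  fixes T :: "'a::euclidean_space \<Rightarrow> 'a"
  assumes T: "orthogonal_transformation T"
  shows "distr lborel borel T = lborel"
proof (rule measure_eqI)
  fix A :: "'a set" assume "A \<in> sets (distr lborel borel T)"
  then have A [measurable]: "A \<in> sets borel" by simp
  have lin: "linear T" using T by (rule orthogonal_transformation_linear)
  then have T_meas [measurable]: "T \<in> borel_measurable borel"
    by (intro borel_measurable_continuous_onI linear_continuous_on linear_conv_bounded_linear[THEN iffD1])
  let ?B = "ball (0::'a) 1"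
  define f g where "f = (indicator ?B :: 'a \<Rightarrow> ennreal)" and "g = (indicator A :: 'a \<Rightarrow> ennreal)"
  have [measurable]: "f \<in> borel_measurable borel" "g \<in> borel_measurable borel"
    using A unfolding f_def g_def by (simp_all add: borel_measurable_indicator)
  have inv: "(\<integral>\<^sup>+x. h (a + T x) \<partial>lborel) = (\<integral>\<^sup>+x. h (T x) \<partial>lborel)"
    if [measurable]: "h \<in> borel_measurable borel" for h :: "'a \<Rightarrow> ennreal" and a
  proof -
    \<comment> \<open>A shift by \<open>a = T b\<close> after \<open>T\<close> is a shift by
      \<open>b\<close> before \<open>T\<close>, which Lebesgue measure does not see.\<close>
    obtain b where "a = T b" using orthogonal_transformation_surj[OF T] by (metis surjD)
    then have "(\<integral>\<^sup>+x. h (a + T x) \<partial>lborel) = (\<integral>\<^sup>+x. h (T (b + x)) \<partial>lborel)"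
      by (simp add: linear_add[OF lin])
    then show ?thesis
      using nn_integral_lborel_translation[of "\<lambda>x. h (T x)" b] by simp
  qed
  have f_even: "f (- x) = f x" and f_T: "f (T x) = f x" for x
    using orthogonal_transformation_norm[OF T, of x] by (auto simp: f_def indicator_def)
  have "emeasure lborel ?B * emeasure lborel A = (\<integral>\<^sup>+x. f (T x) * (\<integral>\<^sup>+y. g y \<partial>lborel) \<partial>lborel)"
    unfolding f_T by (subst nn_integral_multc) (use A in \<open>simp_all add: f_def g_def borel_measurable_indicator\<close>)
  also have "\<dots> = (\<integral>\<^sup>+x. \<integral>\<^sup>+y. f (T x) * g (T x + y) \<partial>lborel \<partial>lborel)"
    by (simp add: nn_integral_cmult nn_integral_lborel_translation)
  also have "\<dots> = (\<integral>\<^sup>+y. \<integral>\<^sup>+x. f (T x) * g (T x + y) \<partial>lborel \<partial>lborel)"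
    by (intro lborel_pair.Fubini') simp
  \<comment> \<open>For fixed \<open>y\<close> the integrand is \<open>f (z - y) * g z\<close> at
    \<open>z = y + T x\<close>, and \<open>inv\<close> removes the shift by
    \<open>y\<close>.\<close>
  also have "\<dots> = (\<integral>\<^sup>+y. \<integral>\<^sup>+x. f (T x - y) * g (T x) \<partial>lborel \<partial>lborel)"
    using inv[of "\<lambda>z. f (z - y) * g z" y for y] by (simp add: add.commute)
  also have "\<dots> = (\<integral>\<^sup>+x. \<integral>\<^sup>+y. f (T x - y) * g (T x) \<partial>lborel \<partial>lborel)"
    by (intro lborel_pair.Fubini') simp
  also have "\<dots> = (\<integral>\<^sup>+x. (\<integral>\<^sup>+y. f (- T x + y) \<partial>lborel) * g (T x) \<partial>lborel)"
    using f_even[of "T x - y" for x y] by (simp add: nn_integral_multc)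
  also have "\<dots> = emeasure lborel ?B * (\<integral>\<^sup>+x. g (T x) \<partial>lborel)"
    by (subst nn_integral_lborel_translation) (simp_all add: nn_integral_cmult, simp add: f_def)
  also have "(\<integral>\<^sup>+x. g (T x) \<partial>lborel) = emeasure (distr lborel borel T) A"
    using nn_integral_distr[of T lborel borel g] A by (simp add: g_def)
  finally have eq: "emeasure lborel ?B * emeasure lborel A = emeasure lborel ?B * emeasure (distr lborel borel T) A" .
  moreover have "emeasure lborel ?B \<noteq> \<top>"
    using emeasure_lborel_ball_finite[of 0 1] by (simp add: less_top)
  moreover have "emeasure lborel ?B \<noteq> 0"
    using open_not_negligible[of ?B] by (auto simp: negligible_iff_emeasure0)
  ultimately show "emeasure (distr lborel borel T) A = emeasure lborel A"
    by (simp add: ennreal_mult_cancel_left)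
qed simp

section \<open>The Gaussian measure as a product of standard normal laws\<close>

lemma prob_space_std_normal: "prob_space std_normal"
  by (rule prob_space_normal_density) simp

lemma product_sigma_finite_std_normal: "product_sigma_finite (\<lambda>_. std_normal)"
  unfolding product_sigma_finite_def
  using prob_space_std_normal prob_space_imp_sigma_finite by blast

lemma product_sigma_finite_lborel: "product_sigma_finite (\<lambda>_. lborel :: real measure)"
  unfolding product_sigma_finite_def by (auto intro: sigma_finite_lborel)

lemma sets_PiM_std_normal [measurable_cong]:
  "sets (Pi\<^sub>M I (\<lambda>_. std_normal)) = sets (Pi\<^sub>M I (\<lambda>_. borel))"
  by (intro sets_PiM_cong) auto

lemma sets_PiM_lborel [measurable_cong]:
  "sets (Pi\<^sub>M I (\<lambda>_. lborel)) = sets (Pi\<^sub>M I (\<lambda>_. borel))"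
  by (intro sets_PiM_cong) auto

text \<open>Induction over the coordinates: Tonelli splits off coordinate \<open>i\<close> on both
  sides, and its density factor is exposed in the inner integral.\<close>

lemma nn_integral_PiM_std_normal:
  assumes "finite I" "G \<in> borel_measurable (Pi\<^sub>M I (\<lambda>_. borel))"
  shows "(\<integral>\<^sup>+w. G w \<partial>Pi\<^sub>M I (\<lambda>_. std_normal))
    = (\<integral>\<^sup>+w. G w * (\<Prod>i\<in>I. ennreal (std_normal_density (w i))) \<partial>Pi\<^sub>M I (\<lambda>_. lborel))"
  using assms
proof (induction I arbitrary: G rule: finite_induct)
  case empty
  then show ?case by (simp add: PiM_empty nn_integral_count_space_finite)
next
  case (insert i I)
  interpret N: product_sigma_finite "\<lambda>_. std_normal" by (rule product_sigma_finite_std_normal)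
  interpret L: product_sigma_finite "\<lambda>_. lborel :: real measure" by (rule product_sigma_finite_lborel)
  interpret SN: prob_space std_normal by (rule prob_space_std_normal)
  note [measurable] = insert.prems
  have [measurable]: "(\<lambda>(w, t). w(i := t)) \<in> Pi\<^sub>M I (\<lambda>_. borel) \<Otimes>\<^sub>M borel \<rightarrow>\<^sub>M Pi\<^sub>M (insert i I) (\<lambda>_. borel :: real measure)"
    by (rule measurable_add_dim)
  let ?\<phi> = "\<lambda>t. ennreal (std_normal_density t)"
  have "(\<integral>\<^sup>+w. G w \<partial>Pi\<^sub>M (insert i I) (\<lambda>_. std_normal))
     = (\<integral>\<^sup>+w. (\<integral>\<^sup>+t. G (w(i := t)) \<partial>std_normal) \<partial>Pi\<^sub>M I (\<lambda>_. std_normal))"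
    using insert.hyps by (intro N.product_nn_integral_insert) auto
  also have "\<dots> = (\<integral>\<^sup>+w. (\<integral>\<^sup>+t. G (w(i := t)) \<partial>std_normal) * (\<Prod>j\<in>I. ?\<phi> (w j)) \<partial>Pi\<^sub>M I (\<lambda>_. lborel))"
    by (rule insert.IH) measurable
  also have "\<dots> = (\<integral>\<^sup>+w. (\<integral>\<^sup>+t. G (w(i := t)) * (\<Prod>j\<in>insert i I. ?\<phi> ((w(i := t)) j)) \<partial>lborel) \<partial>Pi\<^sub>M I (\<lambda>_. lborel))"
  proof (intro nn_integral_cong)
    fix w :: "'a \<Rightarrow> real" assume "w \<in> space (Pi\<^sub>M I (\<lambda>_. lborel))"
    \<comment> \<open>Membership of \<open>w\<close> in the product space is what makes the section
      of \<open>G\<close> at \<open>w\<close> measurable in \<open>t\<close>.\<close>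
    then have [measurable]: "(\<lambda>t. G (w(i := t))) \<in> borel_measurable borel"
      by (intro measurable_compose[OF measurable_Pair1'[of w "Pi\<^sub>M I (\<lambda>_. borel)" borel], of "\<lambda>p. G ((fst p)(i := snd p))", simplified])
        (auto simp: space_PiM)
    have prod_eq: "(\<Prod>j\<in>insert i I. ?\<phi> ((w(i := t)) j)) = ?\<phi> t * (\<Prod>j\<in>I. ?\<phi> (w j))" for t
      using insert.hyps by (subst prod.insert) (auto intro!: arg_cong2[where f = "(*)"] prod.cong)
    have "(\<integral>\<^sup>+t. G (w(i := t)) \<partial>std_normal) * (\<Prod>j\<in>I. ?\<phi> (w j))
       = (\<integral>\<^sup>+t. G (w(i := t)) * (\<Prod>j\<in>I. ?\<phi> (w j)) \<partial>std_normal)"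
      by (subst nn_integral_multc) auto
    also have "\<dots> = (\<integral>\<^sup>+t. ?\<phi> t * (G (w(i := t)) * (\<Prod>j\<in>I. ?\<phi> (w j))) \<partial>lborel)"
      by (subst nn_integral_density) auto
    finally show "(\<integral>\<^sup>+t. G (w(i := t)) \<partial>std_normal) * (\<Prod>j\<in>I. ?\<phi> (w j))
       = (\<integral>\<^sup>+t. G (w(i := t)) * (\<Prod>j\<in>insert i I. ?\<phi> ((w(i := t)) j)) \<partial>lborel)"
      unfolding prod_eq by (simp only: mult_ac)
  qed
  also have "\<dots> = (\<integral>\<^sup>+w. G w * (\<Prod>j\<in>insert i I. ?\<phi> (w j)) \<partial>Pi\<^sub>M (insert i I) (\<lambda>_. lborel))"
    using insert.hyps by (intro L.product_nn_integral_insert[symmetric]) auto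
  finally show ?case .
qed

text \<open>Only the norm of \<open>x\<close> enters on the right, so orthogonal maps preserve the
  density.\<close>

lemma prod_std_normal_density_eq:
  fixes x :: "real ^ 'n"
  shows "(\<Prod>i\<in>UNIV. std_normal_density (x $ i)) = (1 / sqrt (2 * pi)) ^ CARD('n) * exp (- (norm x)\<^sup>2 / 2)"
  unfolding std_normal_density_def prod.distrib
  by (simp add: exp_sum[symmetric] sum_negf sum_divide_distrib[symmetric] norm_vec_def L2_set_def sum_nonneg)

lemma prod_std_normal_density_Basis:
  fixes x :: "real ^ 'n"
  shows "ennreal (\<Prod>i\<in>UNIV. std_normal_density (x $ i)) = (\<Prod>b\<in>Basis. ennreal (std_normal_density (x \<bullet> b)))"
proof -
  have B: "Basis = (\<lambda>i::'n. axis i (1::real)) ` UNIV"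
    by (auto simp: Basis_vec_def)
  have inj: "inj (\<lambda>i::'n. axis i (1::real))"
    by (auto simp: inj_on_def axis_eq_axis)
  show ?thesis
    unfolding B prod.reindex[OF inj] by (simp add: prod_ennreal inner_axis)
qed

text \<open>Lebesgue measure and the density are both invariant under \<open>T\<close>, so the
  coordinates in the orthonormal basis of the vectors \<open>T b\<close> are again independent and
  standard normal. The coordinate along \<open>T e\<close> is outermost, which leaves an integral
  over the slice orthogonal to \<open>T e\<close> inside.\<close>

lemma nn_integral_std_gaussian:
  fixes F :: "real ^ 'n \<Rightarrow> ennreal" and T :: "real ^ 'n \<Rightarrow> real ^ 'n"
  assumes [measurable]: "F \<in> borel_measurable borel" and T: "orthogonal_transformation T" and e: "e \<in> Basis"
  shows "(\<integral>\<^sup>+x. F x \<partial>std_gaussian) = (\<integral>\<^sup>+s. (\<integral>\<^sup>+w. F (s *\<^sub>R T e + (\<Sum>b\<in>Basis - {e}. w b *\<^sub>R T b))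
      \<partial>Pi\<^sub>M (Basis - {e}) (\<lambda>_. std_normal)) \<partial>std_normal)"
proof -
  let ?B = "Basis :: (real ^ 'n) set"
  let ?\<rho> = "\<lambda>x :: real ^ 'n. ennreal (\<Prod>i\<in>UNIV. std_normal_density (x $ i))"
  interpret N: product_sigma_finite "\<lambda>_. std_normal" by (rule product_sigma_finite_std_normal)
  have lin: "linear T" using T by (rule orthogonal_transformation_linear)
  then have [measurable]: "T \<in> borel_measurable borel"
    by (intro borel_measurable_continuous_onI linear_continuous_on linear_conv_bounded_linear[THEN iffD1])
  have \<rho> [measurable]: "?\<rho> \<in> borel_measurable borel"
    unfolding prod_std_normal_density_Basis by measurable
  have \<rho>_T: "?\<rho> (T x) = ?\<rho> x" for x
    by (simp add: prod_std_normal_density_eq orthogonal_transformation_norm[OF T])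
  have \<rho>_sum: "?\<rho> (\<Sum>b\<in>?B. w b *\<^sub>R b) = (\<Prod>b\<in>?B. ennreal (std_normal_density (w b)))" for w
    unfolding prod_std_normal_density_Basis by (intro prod.cong) (auto simp: inner_sum_left inner_Basis if_distrib cong: if_cong)
  have [measurable]: "(\<lambda>w. \<Sum>b\<in>?B. w b *\<^sub>R T b) \<in> borel_measurable (Pi\<^sub>M ?B (\<lambda>_. borel))"
    by measurable
  have sum_eq: "(\<Sum>b\<in>?B. (w(e := s)) b *\<^sub>R T b) = s *\<^sub>R T e + (\<Sum>b\<in>?B - {e}. w b *\<^sub>R T b)" for w s
    using e by (simp add: sum.remove)
  \<comment> \<open>As \<open>F\<close> is Borel, the completed measure gives the same integral as
    \<open>lborel\<close>.\<close>
  have "(\<integral>\<^sup>+x. F x \<partial>std_gaussian) = (\<integral>\<^sup>+x. ?\<rho> x * F x \<partial>lborel)"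
    unfolding std_gaussian_def
    by (subst nn_integral_density) (auto intro!: measurable_completion simp: nn_integral_completion)
  also have "\<dots> = (\<integral>\<^sup>+x. ?\<rho> x * F x \<partial>distr lborel borel T)"
    by (simp add: lborel_distr_orthogonal[OF T])
  also have "\<dots> = (\<integral>\<^sup>+x. ?\<rho> x * F (T x) \<partial>lborel)"
    by (subst nn_integral_distr) (auto simp: \<rho>_T)
  \<comment> \<open>\<open>lborel_eq\<close> presents Lebesgue measure as the image of a product
    measure under expansion in the basis.\<close>
  also have "\<dots> = (\<integral>\<^sup>+w. ?\<rho> (\<Sum>b\<in>?B. w b *\<^sub>R b) * F (T (\<Sum>b\<in>?B. w b *\<^sub>R b)) \<partial>Pi\<^sub>M ?B (\<lambda>_. lborel))"
    by (subst lborel_eq) (subst nn_integral_distr, auto)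
  also have "\<dots> = (\<integral>\<^sup>+w. F (\<Sum>b\<in>?B. w b *\<^sub>R T b) * (\<Prod>b\<in>?B. ennreal (std_normal_density (w b))) \<partial>Pi\<^sub>M ?B (\<lambda>_. lborel))"
    unfolding \<rho>_sum by (simp add: linear_sum[OF lin] linear_scale[OF lin] mult.commute)
  also have "\<dots> = (\<integral>\<^sup>+w. F (\<Sum>b\<in>?B. w b *\<^sub>R T b) \<partial>Pi\<^sub>M ?B (\<lambda>_. std_normal))"
    by (subst nn_integral_PiM_std_normal) auto
  also have "\<dots> = (\<integral>\<^sup>+w. F (\<Sum>b\<in>?B. w b *\<^sub>R T b) \<partial>Pi\<^sub>M (insert e (?B - {e})) (\<lambda>_. std_normal))"
    using e by (simp add: insert_absorb)
  also have "\<dots> = (\<integral>\<^sup>+s. (\<integral>\<^sup>+w. F (\<Sum>b\<in>?B. (w(e := s)) b *\<^sub>R T b)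
      \<partial>Pi\<^sub>M (?B - {e}) (\<lambda>_. std_normal)) \<partial>std_normal)"
    using e by (intro N.product_nn_integral_insert_rev) (auto simp: insert_absorb)
  finally show ?thesis
    unfolding sum_eq .
qed

subsection \<open>Gaussian marginals of log-concave functions\<close>

text \<open>For an indicator and orthonormal \<open>c\<close> this is the Gaussian measure, centred
  at \<open>x\<close>, of a slice through \<open>x\<close>. The arbitrary index set permits
  induction on the number of directions.\<close>

definition gauss_marginal ::
  "'i set \<Rightarrow> ('i \<Rightarrow> 'a::euclidean_space) \<Rightarrow> ('a \<Rightarrow> ennreal) \<Rightarrow> 'a \<Rightarrow> ennreal" where
  "gauss_marginal I c F x = (\<integral>\<^sup>+w. F (x + (\<Sum>i\<in>I. w i *\<^sub>R c i)) \<partial>Pi\<^sub>M I (\<lambda>_. std_normal))"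

lemma prob_space_PiM_std_normal: "prob_space (Pi\<^sub>M I (\<lambda>_. std_normal))"
  by (intro prob_space_PiM prob_space_std_normal)

lemma gauss_marginal_measurable [measurable]:
  assumes [measurable]: "F \<in> borel_measurable borel"
  shows "gauss_marginal I c F \<in> borel_measurable borel"
proof -
  interpret prob_space "Pi\<^sub>M I (\<lambda>_. std_normal)" by (rule prob_space_PiM_std_normal)
  show ?thesis unfolding gauss_marginal_def by measurable
qed

lemma gauss_marginal_le_1:
  assumes "\<And>x. F x \<le> 1"
  shows "gauss_marginal I c F x \<le> 1"
proof -
  interpret prob_space "Pi\<^sub>M I (\<lambda>_. std_normal)" by (rule prob_space_PiM_std_normal)
  have "gauss_marginal I c F x \<le> (\<integral>\<^sup>+w. 1 \<partial>Pi\<^sub>M I (\<lambda>_. std_normal))"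
    unfolding gauss_marginal_def by (intro nn_integral_mono assms)
  then show ?thesis by (simp add: emeasure_space_1)
qed

lemma gauss_marginal_empty: "gauss_marginal {} c F = F"
  by (auto simp: gauss_marginal_def PiM_empty nn_integral_count_space_finite)

lemma gauss_marginal_insert:
  assumes I: "finite I" "i \<notin> I" and [measurable]: "F \<in> borel_measurable borel"
  shows "gauss_marginal (insert i I) c F = gauss_marginal I c (\<lambda>x. \<integral>\<^sup>+t. F (x + t *\<^sub>R c i) \<partial>std_normal)"
proof
  fix x
  interpret N: product_sigma_finite "\<lambda>_. std_normal" by (rule product_sigma_finite_std_normal)
  have sum: "x + (\<Sum>j\<in>insert i I. (w(i := t)) j *\<^sub>R c j) = x + (\<Sum>j\<in>I. w j *\<^sub>R c j) + t *\<^sub>R c i" for w t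
  proof -
    have "(\<Sum>j\<in>I. (w(i := t)) j *\<^sub>R c j) = (\<Sum>j\<in>I. w j *\<^sub>R c j)"
      using I by (intro sum.cong) auto
    then show ?thesis using I by simp
  qed
  have "(\<lambda>w. F (x + (\<Sum>j\<in>insert i I. w j *\<^sub>R c j))) \<in> borel_measurable (Pi\<^sub>M (insert i I) (\<lambda>_. std_normal))"
    by measurable
  then show "gauss_marginal (insert i I) c F x
      = gauss_marginal I c (\<lambda>x. \<integral>\<^sup>+t. F (x + t *\<^sub>R c i) \<partial>std_normal) x"
    unfolding gauss_marginal_def by (simp only: N.product_nn_integral_insert[OF I] sum)
qed

text \<open>One direction is integrated out at a time by \<open>log_concave_marginal\<close>. The
  induction varies \<open>F\<close>; the bound by 1 survives each step because
  \<open>std_normal\<close> has total mass 1.\<close>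

lemma log_concave_gauss_marginal:
  assumes "finite I" "F \<in> borel_measurable borel" "log_concave F" "\<And>x. F x \<le> 1"
  shows "log_concave (gauss_marginal I c F)"
  using assms
proof (induction I arbitrary: F rule: finite_induct)
  case empty
  then show ?case by (simp add: gauss_marginal_empty)
next
  case (insert i I)
  interpret SN: prob_space std_normal by (rule prob_space_std_normal)
  note [measurable] = insert.prems(1)
  show ?case
    unfolding gauss_marginal_insert[OF insert.hyps insert.prems(1)]
  proof (rule insert.IH)
    show "log_concave (\<lambda>x. \<integral>\<^sup>+t. F (x + t *\<^sub>R c i) \<partial>std_normal)"
      using insert.prems by (intro log_concave_marginal)
    fix x
    have "(\<integral>\<^sup>+t. F (x + t *\<^sub>R c i) \<partial>std_normal) \<le> (\<integral>\<^sup>+t. 1 \<partial>std_normal)"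
      by (intro nn_integral_mono insert.prems)
    also have "\<dots> = 1" by (simp only: nn_integral_const SN.emeasure_space_1 mult_1)
    finally show "(\<integral>\<^sup>+t. F (x + t *\<^sub>R c i) \<partial>std_normal) \<le> 1" .
  qed measurable
qed

lemma nn_integral_std_normal_uminus:
  fixes h :: "real \<Rightarrow> ennreal"
  assumes [measurable]: "h \<in> borel_measurable borel"
  shows "(\<integral>\<^sup>+t. h (- t) \<partial>std_normal) = (\<integral>\<^sup>+t. h t \<partial>std_normal)"
proof -
  let ?\<phi> = "\<lambda>t. ennreal (std_normal_density t)"
  have "(\<integral>\<^sup>+t. h t \<partial>std_normal) = (\<integral>\<^sup>+t. ?\<phi> t * h t \<partial>distr lborel borel uminus)"
    by (simp add: nn_integral_density lborel_distr_orthogonal orthogonal_transformation_neg)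
  also have "\<dots> = (\<integral>\<^sup>+t. ?\<phi> t * h (- t) \<partial>lborel)"
    by (subst nn_integral_distr) (auto simp: normal_density_def)
  finally show ?thesis by (simp add: nn_integral_density)
qed

text \<open>In each direction the sign change of \<open>x\<close> is absorbed by the reflection of
  \<open>t\<close>, under which the normal law is invariant.\<close>

lemma gauss_marginal_even:
  assumes "finite I" "F \<in> borel_measurable borel" "\<And>x. F (- x) = F x"
  shows "gauss_marginal I c F (- x) = gauss_marginal I c F x"
  using assms
proof (induction I arbitrary: F rule: finite_induct)
  case empty
  then show ?case by (simp add: gauss_marginal_empty)
next
  case (insert i I)
  interpret SN: prob_space std_normal by (rule prob_space_std_normal)
  note [measurable] = insert.prems(1)
  show ?case
    unfolding gauss_marginal_insert[OF insert.hyps insert.prems(1)]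
  proof (rule insert.IH)
    fix x
    show "(\<integral>\<^sup>+t. F (- x + t *\<^sub>R c i) \<partial>std_normal) = (\<integral>\<^sup>+t. F (x + t *\<^sub>R c i) \<partial>std_normal)"
      using nn_integral_std_normal_uminus[of "\<lambda>t. F (- x + t *\<^sub>R c i)"] insert.prems(2)[of "x + t *\<^sub>R c i" for t]
      by simp
  qed measurable
qed

text \<open>A lower bound \<open>exp \<alpha>\<close> for the indicator forces the point into
  \<open>L\<close> and the exponent to be nonpositive; both conditions survive convex
  combination.\<close>

lemma log_concave_indicator:
  assumes "convex L"
  shows "log_concave (indicator L)"
  unfolding log_concave_def
proof (intro allI impI)
  fix x y \<alpha> \<beta> and u :: real
  assume u: "0 \<le> u" "u \<le> 1"
    and "ennreal (exp \<alpha>) \<le> indicator L x" "ennreal (exp \<beta>) \<le> indicator L y"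
  then have "x \<in> L" "y \<in> L" "\<alpha> \<le> 0" "\<beta> \<le> 0"
    by (auto simp: ennreal_le_1 ennreal_le_iff2 not_le[symmetric] split: split_indicator_asm)
  moreover from this have "(1 - u) * \<alpha> + u * \<beta> \<le> 0"
    using u by (simp add: add_nonpos_nonpos mult_nonneg_nonpos)
  ultimately show "ennreal (exp ((1 - u) * \<alpha> + u * \<beta>)) \<le> indicator L ((1 - u) *\<^sub>R x + u *\<^sub>R y)"
    using convexD[OF assms, of x y "1 - u" u] u by (simp add: ennreal_le_1)
qed

text \<open>The point \<open>s *\<^sub>R v\<close> lies between \<open>t *\<^sub>R v\<close> and its
  negative, where \<open>F\<close> takes one common value.\<close>

lemma log_concave_even_antimono:
  fixes F :: "'a::real_vector \<Rightarrow> ennreal"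
  assumes F: "log_concave F" "\<And>x. F (- x) = F x" "\<And>x. F x \<le> 1" and s: "\<bar>s\<bar> \<le> \<bar>t\<bar>"
  shows "F (t *\<^sub>R v) \<le> F (s *\<^sub>R v)"
proof (cases "F (t *\<^sub>R v) = 0 \<or> t = 0")
  case True
  then show ?thesis using s by auto
next
  case False
  then obtain r where r: "F (t *\<^sub>R v) = ennreal r" "r > 0"
    using F(3)[of "t *\<^sub>R v"] by (cases "F (t *\<^sub>R v)") (auto simp: top_unique less_le)
  \<comment> \<open>The weight solves \<open>(1 - 2 * u) * t = s\<close>.\<close>
  define u where "u = (1 - s / t) / 2"
  have u: "0 \<le> u" "u \<le> 1"
    using False s unfolding u_def by (auto simp: field_simps abs_if split: if_splits)
  have "((1 - u) * t - u * t) = s"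
    using False unfolding u_def by (simp add: field_simps)
  then have eq: "(1 - u) *\<^sub>R (t *\<^sub>R v) + u *\<^sub>R (- (t *\<^sub>R v)) = s *\<^sub>R v"
    by (simp add: scaleR_left_diff_distrib[symmetric])
  have "ennreal (exp ((1 - u) * ln r + u * ln r)) \<le> F ((1 - u) *\<^sub>R (t *\<^sub>R v) + u *\<^sub>R (- (t *\<^sub>R v)))"
    using r by (intro log_concaveD[OF F(1) u]) (auto simp: F(2))
  then show ?thesis
    unfolding eq using r by (simp add: algebra_simps)
qed

lemma std_normal_1_minus_square:
  "integrable std_normal (\<lambda>t. 1 - t\<^sup>2)" "(\<integral>t. 1 - t\<^sup>2 \<partial>std_normal) = 0"
proof -
  have 0: "has_bochner_integral lborel (\<lambda>x. std_normal_density x * x ^ (2 * 0)) 1"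
    using std_normal_moment_even[of 0] by simp
  have 1: "has_bochner_integral lborel (\<lambda>x. std_normal_density x * x ^ (2 * 1)) 1"
    using std_normal_moment_even[of 1] by simp
  have "has_bochner_integral lborel (\<lambda>x. std_normal_density x *\<^sub>R (1 - x\<^sup>2)) 0"
    using has_bochner_integral_diff[OF 0 1] by (simp add: algebra_simps power2_eq_square)
  then have "has_bochner_integral std_normal (\<lambda>t. 1 - t\<^sup>2) 0"
    by (intro has_bochner_integral_density) auto
  then show "integrable std_normal (\<lambda>t. 1 - t\<^sup>2)" "(\<integral>t. 1 - t\<^sup>2 \<partial>std_normal) = 0"
    by (auto simp: has_bochner_integral_iff)
qed

subsection \<open>Symmetric convex sets and their slices\<close>

lemma centrally_symmetric_iff: "centrally_symmetric K \<longleftrightarrow> (\<forall>x \<in> K. - x \<in> K)"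
proof -
  have "centrally_symmetric K \<longleftrightarrow> (\<forall>x. x \<in> K \<longleftrightarrow> - x \<in> K)"
    unfolding centrally_symmetric_def indicator_def by (metis zero_neq_one of_bool_eq_iff)
  then show ?thesis by (metis minus_minus)
qed

lemma zero_in_convex_symmetric:
  assumes "convex L" "centrally_symmetric L" "L \<noteq> {}"
  shows "0 \<in> L"
proof -
  obtain x where "x \<in> L" using assms(3) by auto
  then have "x \<in> L" "- x \<in> L" using assms(2) by (auto simp: centrally_symmetric_iff)
  from convexD[OF assms(1) this, of "1/2" "1/2"] show ?thesis by simp
qed

text \<open>Otherwise, for some large \<open>n\<close>, the missing point on the line would lie on a
  segment from \<open>real n *\<^sub>R v + y\<close> to a point close to 0, with both ends in
  \<open>L\<close>.\<close>

lemma convex_symmetric_recession: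
  fixes L :: "(real ^ 'n) set"
  assumes L: "convex L" "open L" "centrally_symmetric L" "0 \<in> L" and a: "a *\<^sub>R v \<notin> L"
  shows "eventually (\<lambda>n. real n *\<^sub>R v + y \<notin> L) sequentially"
proof -
  \<comment> \<open>By symmetry the missing point may be taken with a nonnegative
    coefficient.\<close>
  define b where "b = \<bar>a\<bar>"
  have bv: "b *\<^sub>R v \<notin> L"
  proof -
    have "- (a *\<^sub>R v) \<notin> L" using L(3) a unfolding centrally_symmetric_iff by (metis minus_minus)
    then show ?thesis using a by (auto simp: b_def abs_if)
  qed
  have b: "0 \<le> b" by (simp add: b_def)
  obtain r where r: "r > 0" "ball 0 r \<subseteq> L"
    using L(2,4) open_contains_ball by metis
  have "real n *\<^sub>R v + y \<notin> L" if n: "real n > b + b * norm y / r" for n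
  proof
    assume in_L: "real n *\<^sub>R v + y \<in> L"
    have "0 \<le> b * norm y / r" using b r by simp
    then have nb: "real n > b" using n by linarith
    \<comment> \<open>The line from \<open>real n *\<^sub>R v + y\<close> through
      \<open>b *\<^sub>R v\<close> meets the line spanned by \<open>y\<close> in \<open>z\<close>.
      The threshold on \<open>n\<close> puts \<open>z\<close> into the ball of radius
      \<open>r\<close>.\<close>
    define z where "z = - (b / (real n - b)) *\<^sub>R y"
    have "b * norm y < r * (real n - b)"
      using n r(1) by (simp add: field_simps)
    then have "norm z < r"
      using nb b by (simp add: z_def field_simps)
    then have z: "z \<in> L" using r by auto
    define u where "u = b / real n"
    have u: "0 \<le> u" "u \<le> 1" using nb b by (auto simp: u_def)
    have "u *\<^sub>R (real n *\<^sub>R v + y) + (1 - u) *\<^sub>R z = (u * real n) *\<^sub>R v + (u - (1 - u) * (b / (real n - b))) *\<^sub>R y"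
      by (simp add: z_def algebra_simps)
    also have "u * real n = b" using nb b by (simp add: u_def)
    also have "u - (1 - u) * (b / (real n - b)) = 0"
      using nb b by (simp add: u_def field_simps)
    finally have "u *\<^sub>R (real n *\<^sub>R v + y) + (1 - u) *\<^sub>R z = b *\<^sub>R v" by simp
    with convexD[OF L(1) in_L z, of u "1 - u"] u bv show False by simp
  qed
  moreover have "eventually (\<lambda>n. real n > b + b * norm y / r) sequentially"
    using filterlim_real_sequentially by (simp add: filterlim_at_top_dense)
  ultimately show ?thesis by (auto elim: eventually_mono)
qed

text \<open>Openness leaves room to stretch \<open>x\<close> to \<open>(1 + d) *\<^sub>R x\<close>
  inside \<open>L\<close>. Then \<open>x + a *\<^sub>R v\<close> is a convex combination of this
  point and a far point of the line, which lies in \<open>L\<close> by \<open>line\<close>.\<close>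

lemma open_convex_line_invariant:
  fixes L :: "'a::real_normed_vector set"
  assumes L: "convex L" "open L" and line: "\<And>a. a *\<^sub>R v \<in> L"
  shows "x + a *\<^sub>R v \<in> L \<longleftrightarrow> x \<in> L"
proof -
  have imp: "x + a *\<^sub>R v \<in> L" if x: "x \<in> L" for x a
  proof -
    have "((\<lambda>d. (1 + d) *\<^sub>R x) \<longlongrightarrow> (1 + 0) *\<^sub>R x) (at_right 0)"
      by (intro tendsto_intros)
    then have "eventually (\<lambda>d. (1 + d) *\<^sub>R x \<in> L) (at_right 0)"
      using L(2) x by (auto dest: topological_tendstoD)
    then have "eventually (\<lambda>d::real. (1 + d) *\<^sub>R x \<in> L \<and> d > 0) (at_right 0)"
      by (intro eventually_conj eventually_at_right_less)
    then obtain d :: real where d: "(1 + d) *\<^sub>R x \<in> L" "d > 0"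
      using eventually_happens by force
    have "(1 / (1 + d)) *\<^sub>R ((1 + d) *\<^sub>R x) + (d / (1 + d)) *\<^sub>R ((a * (1 + d) / d) *\<^sub>R v) \<in> L"
      using d by (intro convexD[OF L(1)] line) (auto simp: field_simps)
    then show ?thesis using d by simp
  qed
  from imp[of "x + a *\<^sub>R v" "- a"] imp[of x a] show ?thesis by auto
qed

section \<open>Null sets, and passage from a convex set to its interior\<close>

text \<open>The frontier of a convex set is null and contains all points where the set and its
  interior differ; completeness of Lebesgue measure does the rest.\<close>

lemma lebesgue_set_convex:
  fixes K :: "(real ^ 'n) set"
  assumes "convex K"
  shows "K \<in> sets lebesgue" "sym_diff K (interior K) \<in> null_sets lebesgue"
proof -
  have fr: "frontier K \<in> null_sets lebesgue"
    using negligible_convex_frontier[OF assms] by (simp add: negligible_iff_null_sets)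
  have sub: "sym_diff K (interior K) \<subseteq> frontier K"
    using closure_subset interior_subset by (auto simp: frontier_def)
  then show null: "sym_diff K (interior K) \<in> null_sets lebesgue"
    using fr by (metis negligible_iff_null_sets negligible_subset)
  have "K = interior K \<union> sym_diff K (interior K)"
    using interior_subset[of K] by auto
  moreover have "interior K \<in> sets lebesgue"
    by (simp add: borel_open sets_completionI_sets)
  ultimately show "K \<in> sets lebesgue"
    using null by (metis null_setsD2 sets.Un)
qed

lemma sets_std_gaussian [simp]: "sets std_gaussian = sets lebesgue"
  by (simp add: std_gaussian_def)

lemma density_measurable_lebesgue:
  "(\<lambda>x::real ^ 'n. ennreal (\<Prod>i\<in>UNIV. std_normal_density (x $ i))) \<in> borel_measurable lebesgue"
proof -
  have "(\<lambda>x::real ^ 'n. ennreal (\<Prod>i\<in>UNIV. std_normal_density (x $ i))) \<in> borel_measurable borel"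
    unfolding prod_std_normal_density_Basis by measurable
  then show ?thesis by (simp add: measurable_completion)
qed

lemma null_sets_std_gaussian:
  "null_sets (std_gaussian :: (real ^ 'n) measure) = null_sets lebesgue"
proof -
  have pos: "\<not> (\<Prod>i\<in>UNIV. std_normal_density (x $ i)) \<le> 0" for x :: "real ^ 'n"
    by (simp add: not_le prod_pos normal_density_pos)
  show ?thesis
  proof (rule set_eqI)
    fix A :: "(real ^ 'n) set"
    have "A \<in> null_sets std_gaussian \<longleftrightarrow> A \<in> sets lebesgue \<and> (AE x in lebesgue. x \<notin> A)"
      unfolding std_gaussian_def null_sets_density_iff[OF density_measurable_lebesgue]
      by (simp add: ennreal_eq_0_iff pos)
    also have "\<dots> \<longleftrightarrow> A \<in> null_sets lebesgue"
      using AE_iff_null_sets[of A lebesgue] null_setsD2[of A lebesgue] by blast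
    finally show "A \<in> null_sets std_gaussian \<longleftrightarrow> A \<in> null_sets lebesgue" .
  qed
qed

lemma borel_measurable_std_gaussian:
  assumes "f \<in> borel_measurable borel"
  shows "f \<in> borel_measurable std_gaussian"
  using assms by (simp add: std_gaussian_def measurable_completion)

text \<open>Allows \<open>K\<close> to be replaced by an open, hence Borel, set, to which Tonelli
  for the slices applies.\<close>

lemma Inf_dir_interior:
  assumes "convex K"
  shows "Inf_dir v K = Inf_dir v (interior K)"
proof -
  have "AE x in std_gaussian. x \<notin> sym_diff K (interior K)"
    using lebesgue_set_convex(2)[OF assms] by (intro AE_not_in) (simp add: null_sets_std_gaussian)
  then have ae: "AE x in std_gaussian. indicat_real K x = indicat_real (interior K) x"
    by (rule AE_mp) (auto intro!: AE_I2 split: split_indicator)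
  have [measurable]: "K \<in> sets std_gaussian" "interior K \<in> sets std_gaussian"
    using lebesgue_set_convex(1)[OF assms] by (auto simp: borel_open sets_completionI_sets)
  have [measurable]: "(\<lambda>x. h2 (v \<bullet> x)) \<in> borel_measurable std_gaussian"
    by (rule borel_measurable_std_gaussian) (simp add: h2_def)
  show ?thesis
    unfolding Inf_dir_def using ae
    by (intro integral_cong_AE) auto
qed

text \<open>Along a direction \<open>v\<close> the set enters only through the Gaussian measures \<open>f s\<close> of its slices
  orthogonal to \<open>v\<close>.\<close>
lemma Inf_dir_slices:
  fixes L :: "(real ^ 'n) set"
  assumes L: "convex L" "open L" "centrally_symmetric L" and v: "norm v = 1"
  obtains f :: "real \<Rightarrow> real" where
    "f \<in> borel_measurable borel"
    "\<And>s. 0 \<le> f s" "\<And>s. f s \<le> 1" "\<And>s t. \<bar>s\<bar> \<le> \<bar>t\<bar> \<Longrightarrow> f t \<le> f s"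
    "integrable std_normal (\<lambda>s. f s * (1 - s\<^sup>2))"
    "Inf_dir v L = (\<integral>s. f s * (1 - s\<^sup>2) \<partial>std_normal) / sqrt 2"
    "emeasure std_gaussian L = (\<integral>\<^sup>+s. ennreal (f s) \<partial>std_normal)"
    "\<And>a. 0 \<in> L \<Longrightarrow> a *\<^sub>R v \<notin> L \<Longrightarrow> (\<lambda>n. f (real n)) \<longlonglongrightarrow> 0"
    "(\<And>x a. x + a *\<^sub>R v \<in> L \<longleftrightarrow> x \<in> L) \<Longrightarrow> \<forall>s. f s = f 0"
proof -
  obtain k :: 'n where True by simp
  define e where "e = (axis k 1 :: real ^ 'n)"
  have e: "e \<in> Basis" by (simp add: e_def)
  \<comment> \<open>\<open>T\<close> supplies an orthonormal basis containing \<open>v\<close>; the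
    images of \<open>J\<close> span the hyperplane orthogonal to \<open>v\<close>.\<close>
  obtain T where T: "orthogonal_transformation T" "T e = v"
    using orthogonal_transformation_exists_1[of e v] e v by auto
  define J where "J = Basis - {e}"
  have J: "finite J" by (simp add: J_def)
  have [measurable]: "L \<in> sets borel" using L(2) by simp
  define M where "M = gauss_marginal J T (indicator L)"
  \<comment> \<open>Nothing is lost under \<open>enn2real\<close>, since \<open>M\<close> is bounded
    by 1.\<close>
  define f where "f s = enn2real (M (s *\<^sub>R v))" for s
  have M_meas [measurable]: "M \<in> borel_measurable borel"
    unfolding M_def by (intro gauss_marginal_measurable) simp
  have ind_le: "indicator L x \<le> (1::ennreal)" for x
    by (simp split: split_indicator)
  have ind_even: "indicator L (- x) = (indicator L x :: ennreal)" for x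
  proof -
    have "- x \<in> L \<longleftrightarrow> x \<in> L"
      using L(3) unfolding centrally_symmetric_iff by (metis minus_minus)
    then show ?thesis by (simp split: split_indicator)
  qed
  have M_le: "M x \<le> 1" for x
    unfolding M_def by (intro gauss_marginal_le_1 ind_le)
  have M_eq: "M (s *\<^sub>R v) = ennreal (f s)" for s
    using M_le[of "s *\<^sub>R v"] unfolding f_def by (simp add: le_less_trans[of _ 1])
  have f_meas [measurable]: "f \<in> borel_measurable borel"
    unfolding f_def by measurable
  have f0: "0 \<le> f s" for s by (simp add: f_def)
  have f1: "f s \<le> 1" for s using M_le[of "s *\<^sub>R v"] f0[of s] by (simp add: M_eq)
  have anti: "f t \<le> f s" if "\<bar>s\<bar> \<le> \<bar>t\<bar>" for s t
  proof -
    have "M (t *\<^sub>R v) \<le> M (s *\<^sub>R v)"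
      using M_le that unfolding M_def
      by (intro log_concave_even_antimono log_concave_gauss_marginal gauss_marginal_even J
          log_concave_indicator L ind_le ind_even borel_measurable_indicator) auto
    then show ?thesis using f0 by (simp add: M_eq)
  qed
  have inner: "v \<bullet> (s *\<^sub>R v + (\<Sum>b\<in>J. w b *\<^sub>R T b)) = s" for s w
  proof -
    have "v \<bullet> T b = 0" if "b \<in> J" for b
      using that e T(1) unfolding T(2)[symmetric] J_def orthogonal_transformation_def
      by (auto simp: inner_not_same_Basis)
    then show ?thesis
      using v by (simp add: inner_add_right inner_sum_right norm_eq_1)
  qed
  have nn: "(\<integral>\<^sup>+x. indicator L x * ennreal (q (v \<bullet> x)) \<partial>std_gaussian)
      = (\<integral>\<^sup>+s. ennreal (f s) * ennreal (q s) \<partial>std_normal)"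
    if [measurable]: "q \<in> borel_measurable borel" for q :: "real \<Rightarrow> real"
  proof -
    have "(\<integral>\<^sup>+x. indicator L x * ennreal (q (v \<bullet> x)) \<partial>std_gaussian)
      = (\<integral>\<^sup>+s. (\<integral>\<^sup>+w. indicator L (s *\<^sub>R v + (\<Sum>b\<in>J. w b *\<^sub>R T b)) * ennreal (q s)
          \<partial>Pi\<^sub>M J (\<lambda>_. std_normal)) \<partial>std_normal)"
      using nn_integral_std_gaussian[OF _ T(1) e, of "\<lambda>x. indicator L x * ennreal (q (v \<bullet> x))"]
      unfolding T(2) J_def[symmetric] inner by simp
    also have "\<dots> = (\<integral>\<^sup>+s. ennreal (f s) * ennreal (q s) \<partial>std_normal)"
      unfolding M_eq[symmetric] M_def gauss_marginal_def
      by (intro nn_integral_cong nn_integral_multc) measurable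
    finally show ?thesis .
  qed
  \<comment> \<open>Nonnegativity of \<open>q\<close> permits the use of \<open>nn\<close>. As
    \<open>1 - s\<^sup>2\<close> changes sign, its two terms are treated separately in
    \<open>I1\<close> and \<open>I2\<close>.\<close>
  have int: "integrable std_normal (\<lambda>s. f s * q s)"
     "has_bochner_integral std_gaussian (\<lambda>x. indicat_real L x * q (v \<bullet> x)) (\<integral>s. f s * q s \<partial>std_normal)"
    if [measurable]: "q \<in> borel_measurable borel" and q: "\<And>s. 0 \<le> q s" "integrable std_normal q"
    for q :: "real \<Rightarrow> real"
  proof -
    show fq: "integrable std_normal (\<lambda>s. f s * q s)"
      using f0 f1 q(1) by (intro Bochner_Integration.integrable_bound[OF q(2)])
        (auto intro!: mult_left_le_one_le)
    have [measurable]: "(\<lambda>x. indicat_real L x * q (v \<bullet> x)) \<in> borel_measurable std_gaussian"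
      by (rule borel_measurable_std_gaussian) measurable
    have "(\<integral>\<^sup>+x. ennreal (indicat_real L x * q (v \<bullet> x)) \<partial>std_gaussian)
        = (\<integral>\<^sup>+x. indicator L x * ennreal (q (v \<bullet> x)) \<partial>std_gaussian)"
      by (intro nn_integral_cong) (auto split: split_indicator)
    also have "\<dots> = (\<integral>\<^sup>+s. ennreal (f s * q s) \<partial>std_normal)"
      using f0 q by (simp add: nn ennreal_mult)
    also have "\<dots> = ennreal (\<integral>s. f s * q s \<partial>std_normal)"
      using f0 q fq by (intro nn_integral_eq_integral) auto
    finally show "has_bochner_integral std_gaussian (\<lambda>x. indicat_real L x * q (v \<bullet> x)) (\<integral>s. f s * q s \<partial>std_normal)"
      using f0 q by (intro has_bochner_integral_nn_integral) (auto intro!: Bochner_Integration.integral_nonneg)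
  qed
  interpret SN: prob_space std_normal by (rule prob_space_std_normal)
  have sq: "integrable std_normal (\<lambda>s. s\<^sup>2)"
    using Bochner_Integration.integrable_diff[OF SN.integrable_const[of 1] std_normal_1_minus_square(1)] by simp
  have one: "integrable std_normal (\<lambda>s. 1 :: real)" by (rule SN.integrable_const)
  note I1 = int[of "\<lambda>_. 1", OF _ _ one, simplified]
  note I2 = int[of "\<lambda>s. s\<^sup>2", OF _ _ sq, simplified]
  have int_f: "integrable std_normal (\<lambda>s. f s * (1 - s\<^sup>2))"
    using Bochner_Integration.integrable_diff[OF I1(1) I2(1)] by (simp add: algebra_simps)
  have "has_bochner_integral std_gaussian (\<lambda>x. (indicat_real L x - indicat_real L x * (v \<bullet> x)\<^sup>2) / sqrt 2)
     (((\<integral>s. f s \<partial>std_normal) - (\<integral>s. f s * s\<^sup>2 \<partial>std_normal)) / sqrt 2)"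
    using I1(2) I2(2) by (intro has_bochner_integral_divide_zero has_bochner_integral_diff) auto
  moreover have "(\<lambda>x. (indicat_real L x - indicat_real L x * (v \<bullet> x)\<^sup>2) / sqrt 2) = (\<lambda>x. - indicat_real L x * h2 (v \<bullet> x))"
    by (auto simp: h2_def field_simps)
  moreover have "(\<integral>s. f s \<partial>std_normal) - (\<integral>s. f s * s\<^sup>2 \<partial>std_normal) = (\<integral>s. f s * (1 - s\<^sup>2) \<partial>std_normal)"
    using Bochner_Integration.integral_diff[OF I1(1) I2(1)] by (simp add: algebra_simps)
  ultimately have "has_bochner_integral std_gaussian (\<lambda>x. - indicat_real L x * h2 (v \<bullet> x))
      ((\<integral>s. f s * (1 - s\<^sup>2) \<partial>std_normal) / sqrt 2)"
    by (simp only:)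
  then have inf: "Inf_dir v L = (\<integral>s. f s * (1 - s\<^sup>2) \<partial>std_normal) / sqrt 2"
    unfolding Inf_dir_def by (rule has_bochner_integral_integral_eq)
  have mass: "emeasure std_gaussian L = (\<integral>\<^sup>+s. ennreal (f s) \<partial>std_normal)"
    using nn[of "\<lambda>_. 1"] by (simp add: sets_completionI_sets)
  \<comment> \<open>By \<open>convex_symmetric_recession\<close> each point of the hyperplane,
    pushed along \<open>v\<close>, eventually stays outside \<open>L\<close>. Dominated convergence
    with bound 1 gives the limit.\<close>
  have lim: "(\<lambda>n. f (real n)) \<longlonglongrightarrow> 0" if "0 \<in> L" "a *\<^sub>R v \<notin> L" for a
  proof -
    let ?P = "Pi\<^sub>M J (\<lambda>_. std_normal)"
    interpret P: prob_space ?P by (rule prob_space_PiM_std_normal)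
    have "(\<lambda>n. \<integral>\<^sup>+w. indicator L (real n *\<^sub>R v + (\<Sum>b\<in>J. w b *\<^sub>R T b)) \<partial>?P) \<longlonglongrightarrow> (\<integral>\<^sup>+w. 0 \<partial>?P)"
    proof (rule nn_integral_dominated_convergence[where w = "\<lambda>_. 1"])
      show "AE w in ?P. (\<lambda>n. indicator L (real n *\<^sub>R v + (\<Sum>b\<in>J. w b *\<^sub>R T b))) \<longlonglongrightarrow> (0::ennreal)"
      proof (intro AE_I2 tendsto_eventually)
        fix w
        show "eventually (\<lambda>n. indicator L (real n *\<^sub>R v + (\<Sum>b\<in>J. w b *\<^sub>R T b)) = (0::ennreal)) sequentially"
          using convex_symmetric_recession[OF L that, of "\<Sum>b\<in>J. w b *\<^sub>R T b"]
          by (rule eventually_mono) simp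
      qed
    qed (auto simp: P.emeasure_space_1 ind_le)
    then have "(\<lambda>n. ennreal (f (real n))) \<longlonglongrightarrow> ennreal 0"
      unfolding M_eq[symmetric] M_def gauss_marginal_def by simp
    then show ?thesis
      by (subst (asm) tendsto_ennreal_iff) (auto simp: f0)
  qed
  have const: "\<forall>s. f s = f 0" if "\<And>x a. x + a *\<^sub>R v \<in> L \<longleftrightarrow> x \<in> L"
  proof
    fix s
    have "s *\<^sub>R v + y \<in> L \<longleftrightarrow> y \<in> L" for y
      using that[of y s] by (simp add: add.commute)
    then have "indicator L (s *\<^sub>R v + y) = (indicator L y :: ennreal)" for y
      by (simp split: split_indicator)
    then have "M (s *\<^sub>R v) = M (0 *\<^sub>R v)"
      unfolding M_def gauss_marginal_def by simp
    then show "f s = f 0" by (simp add: f_def)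
  qed
  show ?thesis
    by (rule that[OF f_meas f0 f1 anti int_f inf mass lim const])
qed

section \<open>Sign and vanishing of the influence\<close>

text \<open>Subtracting the mean-zero function \<open>f 1 * (1 - s\<^sup>2)\<close> leaves a product
  whose factors both change sign where \<open>\<bar>s\<bar> = 1\<close>. Evenness is contained in
  \<open>anti\<close>, applied to \<open>s\<close> and its negative in either order.\<close>

lemma integral_even_antimono_std_normal:
  fixes f :: "real \<Rightarrow> real"
  assumes anti: "\<And>s t. \<bar>s\<bar> \<le> \<bar>t\<bar> \<Longrightarrow> f t \<le> f s"
    and int: "integrable std_normal (\<lambda>s. f s * (1 - s\<^sup>2))"
  shows "0 \<le> (\<integral>s. f s * (1 - s\<^sup>2) \<partial>std_normal)"
    and "(\<integral>s. f s * (1 - s\<^sup>2) \<partial>std_normal) = 0 \<Longrightarrow> AE s in lborel. f s = f 1"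
proof -
  let ?d = "\<lambda>s. (f s - f 1) * (1 - s\<^sup>2)"
  have int1: "integrable std_normal (\<lambda>s. f 1 * (1 - s\<^sup>2))"
    using std_normal_1_minus_square(1) by (rule integrable_mult_right)
  have d: "integrable std_normal ?d"
    using Bochner_Integration.integrable_diff[OF int int1] by (simp add: algebra_simps)
  have eq: "(\<integral>s. f s * (1 - s\<^sup>2) \<partial>std_normal) = (\<integral>s. ?d s \<partial>std_normal)"
    using Bochner_Integration.integral_diff[OF int int1] std_normal_1_minus_square(2)
    by (simp add: left_diff_distrib)
  have nonneg: "0 \<le> ?d s" for s
  proof (cases "\<bar>s\<bar> \<le> 1")
    case True
    then show ?thesis using anti[of s 1] by (intro mult_nonneg_nonneg) (auto simp: abs_square_le_1)
  next
    case False
    then have "f s - f 1 \<le> 0" "1 - s\<^sup>2 \<le> 0"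
      using anti[of 1 s] abs_square_le_1[of s] by linarith+
    then show ?thesis by (rule mult_nonpos_nonpos)
  qed
  show "0 \<le> (\<integral>s. f s * (1 - s\<^sup>2) \<partial>std_normal)"
    unfolding eq using nonneg by (intro Bochner_Integration.integral_nonneg) auto
  assume "(\<integral>s. f s * (1 - s\<^sup>2) \<partial>std_normal) = 0"
  then have "AE s in std_normal. ?d s = 0"
    using integral_nonneg_eq_0_iff_AE[OF d] nonneg unfolding eq by auto
  \<comment> \<open>The normal density is positive, so null sets agree; the factor
    \<open>1 - s\<^sup>2\<close> vanishes only at 1 and -1, two further null points.\<close>
  then have "AE s in lborel. ?d s = 0"
    by (subst (asm) AE_density) (auto simp: normal_density_pos)
  with AE_lborel_singleton[of 1] AE_lborel_singleton[of "-1 :: real"]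
  show "AE s in lborel. f s = f 1"
    by eventually_elim (auto simp: power2_eq_1_iff)
qed

text \<open>If the influence were not positive, the slice measure \<open>f\<close> would be almost
  everywhere constant; as it tends to 0, it would vanish almost everywhere. Then \<open>L\<close>
  would be null, though it is open and contains 0.\<close>

lemma Inf_dir_pos:
  fixes L :: "(real ^ 'n) set"
  assumes L: "convex L" "open L" "centrally_symmetric L" and v: "norm v = 1"
    and "0 \<in> L" "a *\<^sub>R v \<notin> L"
  shows "Inf_dir v L > 0"
proof (rule Inf_dir_slices[OF L v], rule ccontr)
  fix f :: "real \<Rightarrow> real"
  assume neg: "\<not> Inf_dir v L > 0"
    and f: "f \<in> borel_measurable borel" "\<And>s. 0 \<le> f s" "\<And>s t. \<bar>s\<bar> \<le> \<bar>t\<bar> \<Longrightarrow> f t \<le> f s"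
      "integrable std_normal (\<lambda>s. f s * (1 - s\<^sup>2))"
      "Inf_dir v L = (\<integral>s. f s * (1 - s\<^sup>2) \<partial>std_normal) / sqrt 2"
      "emeasure std_gaussian L = (\<integral>\<^sup>+s. ennreal (f s) \<partial>std_normal)"
      "\<And>a. 0 \<in> L \<Longrightarrow> a *\<^sub>R v \<notin> L \<Longrightarrow> (\<lambda>n. f (real n)) \<longlonglongrightarrow> 0"
  have main: "0 \<le> (\<integral>s. f s * (1 - s\<^sup>2) \<partial>std_normal)"
    "(\<integral>s. f s * (1 - s\<^sup>2) \<partial>std_normal) = 0 \<Longrightarrow> AE s in lborel. f s = f 1"
    using integral_even_antimono_std_normal[of f] f(3,4) by blast+
  have "(\<integral>s. f s * (1 - s\<^sup>2) \<partial>std_normal) = 0"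
    using neg main(1) f(5) by (simp add: divide_simps split: if_splits)
  from main(2)[OF this] have ae: "AE s in lborel. f s = f 1" .
  \<comment> \<open>The almost everywhere equality need not hold at integers. But the interval after
    \<open>n\<close> has positive length, so it contains a point with value \<open>f 1\<close>, and
    monotonicity carries the bound back to \<open>n\<close>.\<close>
  have "f 1 \<le> f (real n)" for n
  proof -
    have "\<exists>s>real n. f s = f 1"
    proof (rule ccontr)
      assume none: "\<not> (\<exists>s>real n. f s = f 1)"
      from ae have "AE s in lborel. s \<notin> {real n<..<real n + 1}"
        by eventually_elim (use none in auto)
      then have "emeasure lborel {real n<..<real n + 1} = 0"
        by (subst (asm) AE_iff_null_sets[symmetric]) (auto simp: null_sets_def)
      then show False by simp
    qed
    then obtain s where "s > real n" "f s = f 1" by auto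
    then show ?thesis using f(3)[of "real n" s] by simp
  qed
  then have "f 1 \<le> 0"
    using f(7)[OF assms(5,6)] by (intro LIMSEQ_le_const[of "\<lambda>n. f (real n)"]) auto
  with f(2)[of 1] ae have ae0: "AE s in lborel. f s = 0" by simp
  have "emeasure std_gaussian L = (\<integral>\<^sup>+s. ennreal (std_normal_density s) * ennreal (f s) \<partial>lborel)"
    unfolding f(6) using f(1) by (intro nn_integral_density) auto
  also have "\<dots> = (\<integral>\<^sup>+s. 0 \<partial>(lborel :: real measure))"
    using ae0 by (intro nn_integral_cong_AE) auto
  finally have "L \<in> null_sets std_gaussian"
    using L(2) by (auto simp: borel_open sets_completionI_sets)
  then have "negligible L"
    by (simp add: null_sets_std_gaussian negligible_iff_null_sets)
  with L(2) \<open>0 \<in> L\<close> show False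
    using open_not_negligible by blast
qed

lemma Inf_dir_line_invariant:
  fixes L :: "(real ^ 'n) set"
  assumes L: "convex L" "open L" "centrally_symmetric L" and v: "norm v = 1"
    and inv: "\<And>x a. x + a *\<^sub>R v \<in> L \<longleftrightarrow> x \<in> L"
  shows "Inf_dir v L = 0"
proof (rule Inf_dir_slices[OF L v])
  fix f :: "real \<Rightarrow> real"
  assume f: "Inf_dir v L = (\<integral>s. f s * (1 - s\<^sup>2) \<partial>std_normal) / sqrt 2"
    "(\<And>x a. x + a *\<^sub>R v \<in> L \<longleftrightarrow> x \<in> L) \<Longrightarrow> \<forall>s. f s = f 0"
  from f(2)[OF inv] have "f = (\<lambda>_. f 0)"
    by (intro ext) (rule spec)
  then have "(\<integral>s. f s * (1 - s\<^sup>2) \<partial>std_normal) = (\<integral>s. f 0 * (1 - s\<^sup>2) \<partial>std_normal)"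
    by (rule arg_cong)
  then show ?thesis
    using f(1) std_normal_1_minus_square(2) by simp
qed

lemma Inf_dir_nonneg:
  fixes L :: "(real ^ 'n) set"
  assumes L: "convex L" "open L" "centrally_symmetric L" and v: "norm v = 1"
  shows "0 \<le> Inf_dir v L"
proof (rule Inf_dir_slices[OF L v])
  fix f :: "real \<Rightarrow> real"
  assume "\<And>s t. \<bar>s\<bar> \<le> \<bar>t\<bar> \<Longrightarrow> f t \<le> f s" "integrable std_normal (\<lambda>s. f s * (1 - s\<^sup>2))"
    and Inf: "Inf_dir v L = (\<integral>s. f s * (1 - s\<^sup>2) \<partial>std_normal) / sqrt 2"
  then have "0 \<le> (\<integral>s. f s * (1 - s\<^sup>2) \<partial>std_normal)"
    using integral_even_antimono_std_normal(1)[of f] by blast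
  then show ?thesis by (simp add: Inf)
qed

text \<open>Two small balls, one inside \<open>K\<close> and a translate outside, refute invariance off a null set.\<close>
lemma cylinder_ae_imp_line:
  fixes K :: "(real ^ 'n) set"
  assumes K: "convex K" "0 \<in> interior K" and N: "N \<in> null_sets lebesgue"
    and cyl: "\<And>x a. x \<notin> N \<Longrightarrow> x + a *\<^sub>R v \<notin> N \<Longrightarrow> x \<in> K \<longleftrightarrow> x + a *\<^sub>R v \<in> K"
  shows "a *\<^sub>R v \<in> interior K"
proof (rule ccontr)
  assume a: "a *\<^sub>R v \<notin> interior K"
  \<comment> \<open>Doubling makes \<open>a *\<^sub>R v\<close> the midpoint of 0 and
    \<open>p\<close>. Were \<open>p\<close> in the closure, the midpoint would be interior; so
    \<open>p\<close> even has a neighbourhood outside \<open>K\<close>.\<close>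
  define p where "p = (2 * a) *\<^sub>R v"
  have "p \<notin> closure K"
  proof
    assume "p \<in> closure K"
    then have "open_segment 0 p \<subseteq> interior K"
      using K by (intro in_interior_closure_convex_segment)
    moreover have "a *\<^sub>R v \<in> open_segment 0 p"
    proof -
      have "a *\<^sub>R v \<noteq> 0" using a K(2) by metis
      then show ?thesis
        by (auto simp: p_def in_segment intro!: exI[of _ "1/2"])
    qed
    ultimately show False using a by blast
  qed
  then obtain r1 where r1: "r1 > 0" "ball p r1 \<subseteq> - closure K"
    by (metis Compl_iff closed_closure open_Compl open_contains_ball)
  obtain r2 where r2: "r2 > 0" "ball 0 r2 \<subseteq> K"
    using K(2) by (auto simp: mem_interior)
  define r where "r = min r1 r2"
  have r: "r > 0" using r1 r2 by (simp add: r_def)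
  \<comment> \<open>For \<open>x\<close> in this ball, \<open>x\<close> lies in \<open>K\<close> and
    \<open>x + p\<close> does not, so one of the two must belong to \<open>N\<close>.\<close>
  have "ball 0 r \<subseteq> N \<union> (+) (- p) ` N"
  proof
    fix x :: "real ^ 'n" assume x: "x \<in> ball 0 r"
    then have "x \<in> K" "x + p \<notin> K"
      using r1 r2 closure_subset[of K] by (auto simp: r_def dist_norm subset_iff)
    then have "x \<in> N \<or> x + p \<in> N"
      using cyl[of x "2 * a"] by (auto simp: p_def)
    then show "x \<in> N \<union> (+) (- p) ` N"
      by (auto intro!: image_eqI[of _ _ "x + p"])
  qed
  moreover have "negligible (N \<union> (+) (- p) ` N)"
    using N unfolding negligible_iff_null_sets[symmetric]
    by (intro negligible_Un negligible_translation)
  ultimately have "negligible (ball (0 :: real ^ 'n) r)"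
    by (rule negligible_subset[rotated])
  then show False
    using r open_not_negligible[of "ball (0 :: real ^ 'n) r"] by simp
qed

lemma proj_perp_eq_cong:
  assumes "proj_perp v x = proj_perp v y"
  obtains a where "y = x + a *\<^sub>R v"
proof -
  have "y = x + (v \<bullet> y - v \<bullet> x) *\<^sub>R v"
    using assms by (simp add: proj_perp_def algebra_simps)
  then show ?thesis by (rule that)
qed

lemma proj_perp_add_scaleR:
  assumes "norm v = 1"
  shows "proj_perp v (x + a *\<^sub>R v) = proj_perp v x"
  using assms by (simp add: proj_perp_def inner_add_right norm_eq_1 algebra_simps)

section \<open>Nonnegativity and the equality case\<close>

theorem proposition24:
  fixes K :: "(real ^ 'n) set"
  assumes "convex K" and "centrally_symmetric K"
  shows "\<forall>v \<in> sphere 0 1.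
    Inf_dir v K \<ge> 0 \<and>
    (Inf_dir v K = 0 \<longleftrightarrow>
      (\<exists>N \<in> null_sets lebesgue. \<forall>x y. x \<notin> N \<longrightarrow> y \<notin> N \<longrightarrow> proj_perp v x = proj_perp v y
         \<longrightarrow> indicat_real K x = indicat_real K y))"
proof
  fix v :: "real ^ 'n" assume "v \<in> sphere 0 1"
  then have v: "norm v = 1" by simp
  define L where "L = interior K"
  have sym: "- x \<in> K" if "x \<in> K" for x
    using assms(2) that by (simp add: centrally_symmetric_iff)
  have "uminus ` K = K"
  proof
    show "K \<subseteq> uminus ` K"
      using sym by (intro subsetI image_eqI[of _ uminus "- x" for x]) simp_all
  qed (use sym in blast)
  then have "uminus ` L = L"
    unfolding L_def interior_negations[symmetric] by (rule arg_cong)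
  then have "centrally_symmetric L"
    unfolding centrally_symmetric_iff by (metis imageI)
  then have L: "convex L" "open L" "centrally_symmetric L"
    using assms(1) by (simp_all add: L_def convex_interior)
  have Inf: "Inf_dir v K = Inf_dir v L"
    unfolding L_def by (rule Inf_dir_interior[OF assms(1)])
  let ?C = "\<lambda>N. \<forall>x y. x \<notin> N \<longrightarrow> y \<notin> N \<longrightarrow> proj_perp v x = proj_perp v y
         \<longrightarrow> indicat_real K x = indicat_real K y"
  have "Inf_dir v K = 0 \<longleftrightarrow> (\<exists>N \<in> null_sets lebesgue. ?C N)"
  \<comment> \<open>Invariance of the interior along \<open>v\<close> decides both sides of the
    equivalence: both hold if it is present, both fail if not.\<close>
  proof (cases "\<forall>x a. x + a *\<^sub>R v \<in> L \<longleftrightarrow> x \<in> L")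
    case True
    \<comment> \<open>Off this null set \<open>K\<close> agrees with the invariant set
      \<open>L\<close>.\<close>
    define N where "N = sym_diff K L"
    have "N \<in> null_sets lebesgue"
      unfolding N_def L_def by (rule lebesgue_set_convex(2)[OF assms(1)])
    moreover have "?C N"
    proof (intro allI impI)
      fix x y assume xy: "x \<notin> N" "y \<notin> N" "proj_perp v x = proj_perp v y"
      from xy(3) obtain a where y: "y = x + a *\<^sub>R v" by (rule proj_perp_eq_cong)
      have "y \<in> L \<longleftrightarrow> x \<in> L" unfolding y using True by (elim allE)
      moreover have "x \<in> K \<longleftrightarrow> x \<in> L" "y \<in> K \<longleftrightarrow> y \<in> L"
        using xy(1,2) unfolding N_def by blast+
      ultimately show "indicat_real K x = indicat_real K y"
        by (simp only: indicator_def)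
    qed
    ultimately have "\<exists>N \<in> null_sets lebesgue. ?C N" by (rule bexI[rotated])
    moreover have "Inf_dir v K = 0"
      unfolding Inf
    proof (rule Inf_dir_line_invariant[OF L v])
      fix x a
      show "x + a *\<^sub>R v \<in> L \<longleftrightarrow> x \<in> L" using True by (elim allE)
    qed
    ultimately show ?thesis by (simp only: simp_thms)
  next
    case False
    \<comment> \<open>The empty set is invariant, so an empty interior belongs to the other
      case.\<close>
    have "L \<noteq> {}"
    proof
      assume "L = {}"
      with False show False by simp
    qed
    then have 0: "0 \<in> L" by (rule zero_in_convex_symmetric[OF L(1,3)])
    have "\<not> (\<forall>a. a *\<^sub>R v \<in> L)"
    proof
      assume "\<forall>a. a *\<^sub>R v \<in> L"
      then have "\<forall>x a. x + a *\<^sub>R v \<in> L \<longleftrightarrow> x \<in> L"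
        by (intro allI open_convex_line_invariant[OF L(1,2)]) (rule spec)
      with False show False ..
    qed
    then obtain a where a: "a *\<^sub>R v \<notin> L" by blast
    \<comment> \<open>An exceptional null set would force the whole line spanned by \<open>v\<close>
      into the interior, by \<open>cylinder_ae_imp_line\<close>, against the choice of
      \<open>a\<close>.\<close>
    have "\<not> ?C N" if N: "N \<in> null_sets lebesgue" for N
    proof
      assume C: "?C N"
      have "a *\<^sub>R v \<in> interior K"
      proof (rule cylinder_ae_imp_line[OF assms(1) _ N])
        show "0 \<in> interior K" using 0 by (simp add: L_def)
        fix x b assume "x \<notin> N" "x + b *\<^sub>R v \<notin> N"
        then have "indicat_real K x = indicat_real K (x + b *\<^sub>R v)"
          by (intro C[rule_format] proj_perp_add_scaleR[OF v, symmetric])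
        then show "x \<in> K \<longleftrightarrow> x + b *\<^sub>R v \<in> K"
          by (auto split: split_indicator_asm)
      qed
      then show False using a by (simp add: L_def)
    qed
    moreover have "Inf_dir v K > 0"
      unfolding Inf by (rule Inf_dir_pos[OF L v 0 a])
    ultimately show ?thesis by (metis less_irrefl)
  qed
  moreover have "0 \<le> Inf_dir v K"
    unfolding Inf by (rule Inf_dir_nonneg[OF L v])
  ultimately show "Inf_dir v K \<ge> 0 \<and> (Inf_dir v K = 0 \<longleftrightarrow> (\<exists>N \<in> null_sets lebesgue. ?C N))"
    by (rule conjI[rotated])
qed

end
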